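(* Let $G$ be a finite abelian group that is not an elementary abelian $2$-group, let $\mathbf{k}$ be a field with $\operatorname{char}\mathbf{k}\nmid|G|$, and let $V$ be a faithful finite-dimensional representation of $G$ over $\mathbf{k}$. Then $\gamma_{\mathrm{field}}(G,V)\geq 3$.
   Context: $\mathbf{k}[V]$ is the ring of polynomial functions on $V$, $\mathbf{k}(V)$ its fraction field, with $G$ acting by $(gf)(v)=f(g^{-1}v)$; $\mathbf{k}[V]^G$, $\mathbf{k}(V)^G$ are the invariants, and $\mathbf{k}[V]^G_{\leq d}$ is the space of invariant polynomials of degree at most $d$. $\gamma_{\mathrm{field}}(G,V)$ is the least natural number $d$ such that $\mathbf{k}(V)^G$ is a finite field extension of its subfield $\mathbf{k}(\mathbf{k}[V]^G_{\leq d})$. The trivial group counts as an elementary abelian $2$-group. *)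

theory Defs
  imports
    "HOL-Library.Poly_Mapping"
    "HOL-Computational_Algebra.Fraction_Field"
    "HOL-Algebra.Group_Action"
    "HOL-Algebra.Generated_Fields"
    "HOL-Algebra.Embedded_Algebras"
    "HOL-Algebra.Algebraic_Closure_Type"
begin

section \<open>Polynomials and rational functions in the variables $x_0, x_1, \dots$\<close>

text \<open>
  The countable supply of variables only serves as an ambient domain; the polynomial ring in
  \<open>n\<close> variables is the subring \<open>polys n\<close> below.  Polynomials are formal, so that their
  ring is a domain over finite fields as well.
\<close>

type_synonym 'k mpoly = "(nat \<Rightarrow>\<^sub>0 nat) \<Rightarrow>\<^sub>0 'k"

definition const :: "'k::comm_ring_1 \<Rightarrow> 'k mpoly"
  where "const c = Poly_Mapping.single 0 c"

definition var :: "nat \<Rightarrow> 'k::comm_ring_1 mpoly"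
  where "var i = Poly_Mapping.single (Poly_Mapping.single i 1) 1"

text \<open>
  \<open>insertion h \<sigma> p\<close> substitutes \<open>\<sigma> i\<close> for \<open>x\<^sub>i\<close>, the coefficients being mapped by \<open>h\<close>.
\<close>

definition insertion ::
    "('k::comm_ring_1 \<Rightarrow> 'r::comm_ring_1) \<Rightarrow> (nat \<Rightarrow> 'r) \<Rightarrow> 'k mpoly \<Rightarrow> 'r"
  where "insertion h \<sigma> p = (\<Sum>m\<in>Poly_Mapping.keys p. h (Poly_Mapping.lookup p m) *
           (\<Prod>i\<in>Poly_Mapping.keys m. \<sigma> i ^ Poly_Mapping.lookup m i))"

definition monom_degree :: "(nat \<Rightarrow>\<^sub>0 nat) \<Rightarrow> nat"
  where "monom_degree m = (\<Sum>i\<in>Poly_Mapping.keys m. Poly_Mapping.lookup m i)"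

definition polys :: "nat \<Rightarrow> 'k::comm_ring_1 mpoly set"
  where "polys n = {p. \<forall>m\<in>Poly_Mapping.keys p. Poly_Mapping.keys m \<subseteq> {..<n}}"

definition polys_le :: "nat \<Rightarrow> nat \<Rightarrow> 'k::comm_ring_1 mpoly set"
  where "polys_le n d = {p \<in> polys n. \<forall>m\<in>Poly_Mapping.keys p. monom_degree m \<le> d}"

definition rats :: "nat \<Rightarrow> 'k::field mpoly fract set"
  where "rats n = {Fract a b | a b. a \<in> polys n \<and> b \<in> polys n \<and> b \<noteq> 0}"

definition embed :: "'k::field mpoly \<Rightarrow> 'k mpoly fract"
  where "embed p = Fract p 1"


section \<open>Representations and their invariants\<close>

definition elementary_abelian_2_group :: "('g, 'm) monoid_scheme \<Rightarrow> bool"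
  where "elementary_abelian_2_group G \<longleftrightarrow>
    comm_group G \<and> (\<forall>g\<in>carrier G. g \<noteq> \<one>\<^bsub>G\<^esub> \<longrightarrow> group.ord G g = 2)"

text \<open>
  The vector space is a whole type, with an ordered basis \<open>bs\<close>.  The basis serves to
  identify the ring of polynomial functions on the space with the polynomial ring in the
  coordinate functions.
\<close>

locale linear_representation =
  group_action G "UNIV :: 'v set" \<rho> + finite_dimensional_vector_space scale "set bs"
  for G :: "('g, 'm) monoid_scheme" (structure)
    and \<rho> :: "'g \<Rightarrow> 'v::ab_group_add \<Rightarrow> 'v"
    and scale :: "'k::field \<Rightarrow> 'v \<Rightarrow> 'v"
    and bs :: "'v list" +
  assumes linear_action: "g \<in> carrier G \<Longrightarrow> Vector_Spaces.linear scale scale (\<rho> g)"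
    and distinct_basis: "distinct bs"
begin

definition coord :: "nat \<Rightarrow> 'v \<Rightarrow> 'k"
  where "coord i v = representation (set bs) v (bs ! i)"

text \<open>
  The variable \<open>x\<^sub>i\<close> stands for the coordinate function \<open>coord i\<close>; the action
  \<open>(g f)(v) = f (g\<^sup>-\<^sup>1 v)\<close> sends it to the linear form
  \<open>v \<mapsto> coord i (g\<^sup>-\<^sup>1 v) = (\<Sum>j. coord i (g\<^sup>-\<^sup>1 b\<^sub>j) * coord j v)\<close>.
\<close>

definition poly_act :: "'g \<Rightarrow> 'k mpoly \<Rightarrow> 'k mpoly"
  where "poly_act g = insertion const
    (\<lambda>i. \<Sum>j<length bs. const (coord i (\<rho> (inv g) (bs ! j))) * var j)"

definition rat_act :: "'g \<Rightarrow> 'k mpoly fract \<Rightarrow> 'k mpoly fract"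
  where "rat_act g q = (THE r. \<exists>a\<in>polys (length bs). \<exists>b\<in>polys (length bs).
    b \<noteq> 0 \<and> q = Fract a b \<and> r = Fract (poly_act g a) (poly_act g b))"

definition inv_polys_le :: "nat \<Rightarrow> 'k mpoly set"
  where "inv_polys_le d = {f \<in> polys_le (length bs) d. \<forall>g\<in>carrier G. poly_act g f = f}"

definition inv_rats :: "'k mpoly fract set"
  where "inv_rats = {q \<in> rats (length bs). \<forall>g\<in>carrier G. rat_act g q = q}"

definition inv_field_le :: "nat \<Rightarrow> 'k mpoly fract set"
  where "inv_field_le d = generate_field ring_of_type_algebra
    (embed ` (range const \<union> inv_polys_le d))"

definition gamma_field :: nat
  where "gamma_field =
    (LEAST d. ring.finite_dimension ring_of_type_algebra (inv_field_le d) inv_rats)"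

end

end

(*
  Every variable x is algebraic over k(V)^G, as a root of the product of T - g x over g in G; these
  products have invariant coefficients, so k(V)^G is finite over the field generated by the
  invariants of degree at most d as soon as d is large.

  It remains to exclude d <= 2.  Some g in G has g^2 <> 1, so by faithfulness, and since |G| is
  invertible, a character chi of G over the algebraic closure K with chi^2 <> 1 occurs in the linear
  forms.  The torus t in K^* scales the chi-isotypic part of the linear forms by t, the
  chi^-1-isotypic part by 1/t, and fixes the remaining ones.  It fixes every invariant of degree at
  most 2, because an invariant is an average of products of at most two linear forms, and there a
  factor from the chi-part only pairs with one from the chi^-1-part.  If every variable were
  algebraic over the field generated by these invariants, then its images under the torus would be
  roots of a single nonzero polynomial, hence finite in number; but K is infinite and the chi-part is
  nonzero.
*)
theory Submission
  imports Defs
begin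

section \<open>Substitution into formal polynomials\<close>

text \<open>Padding the support with zero coefficients allows polynomials with different supports to
  be compared term by term.\<close>

lemma insertion_eq_sum:
  assumes "finite S" "Poly_Mapping.keys p \<subseteq> S" "h 0 = 0"
  shows "insertion h \<sigma> p = (\<Sum>m\<in>S. h (Poly_Mapping.lookup p m) *
           (\<Prod>i\<in>Poly_Mapping.keys m. \<sigma> i ^ Poly_Mapping.lookup m i))"
  unfolding insertion_def
  by (rule sum.mono_neutral_left) (use assms in \<open>auto simp: in_keys_iff\<close>)

text \<open>All three products may run over the union of the two supports, since an absent variable
  has exponent 0.\<close>

lemma prod_keys_power_add:
  fixes \<sigma> :: "nat \<Rightarrow> 'r::comm_ring_1"
  shows "(\<Prod>i\<in>Poly_Mapping.keys (m + m'). \<sigma> i ^ Poly_Mapping.lookup (m + m') i) =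
    (\<Prod>i\<in>Poly_Mapping.keys m. \<sigma> i ^ Poly_Mapping.lookup m i) *
    (\<Prod>i\<in>Poly_Mapping.keys m'. \<sigma> i ^ Poly_Mapping.lookup m' i)"
proof -
  let ?S = "Poly_Mapping.keys m \<union> Poly_Mapping.keys m'"
  have *: "(\<Prod>i\<in>Poly_Mapping.keys k. \<sigma> i ^ Poly_Mapping.lookup k i) = (\<Prod>i\<in>?S. \<sigma> i ^ Poly_Mapping.lookup k i)"
    if "Poly_Mapping.keys k \<subseteq> ?S" for k
    by (rule prod.mono_neutral_left) (use that in \<open>auto simp: in_keys_iff\<close>)
  show ?thesis
    unfolding *[OF keys_add] *[OF Un_upper1] *[OF Un_upper2]
    by (simp add: lookup_add power_add prod.distrib)
qed

lemma mpoly_eq_sum: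
  "p = (\<Sum>m\<in>Poly_Mapping.keys p. Poly_Mapping.single m (Poly_Mapping.lookup p m))"
  by (rule poly_mapping_eqI)
    (auto simp: lookup_sum lookup_single when_def in_keys_iff)

text \<open>Unital ring homomorphisms, kept abstract to cover \<open>const\<close>, the extension of
  scalars \<open>\<lambda>c. const (to_ac c)\<close>, and the identity.\<close>

locale coeff_hom =
  fixes h :: "'k::comm_ring_1 \<Rightarrow> 'r::comm_ring_1"
  assumes hom_add: "h (a + b) = h a + h b"
    and hom_mult: "h (a * b) = h a * h b"
    and hom_one: "h 1 = 1"
begin

lemma hom_zero: "h 0 = 0"
  using hom_add[of 0 0] by simp

lemma hom_sum: "h (sum f A) = (\<Sum>a\<in>A. h (f a))"
  by (induction A rule: infinite_finite_induct) (auto simp: hom_zero hom_add)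

lemma insertion_zero [simp]: "insertion h \<sigma> 0 = 0"
  by (simp add: insertion_def)

lemma insertion_single:
  "insertion h \<sigma> (Poly_Mapping.single m c) =
    h c * (\<Prod>i\<in>Poly_Mapping.keys m. \<sigma> i ^ Poly_Mapping.lookup m i)"
  by (simp add: insertion_def hom_zero)

lemma insertion_const [simp]: "insertion h \<sigma> (const c) = h c"
  by (simp add: const_def insertion_single)

lemma insertion_one [simp]: "insertion h \<sigma> 1 = 1"
  using insertion_const[of \<sigma> 1] by (simp add: const_def hom_one)

lemma insertion_var [simp]: "insertion h \<sigma> (var i) = \<sigma> i"
  by (simp add: var_def insertion_single hom_one)

lemma insertion_add [simp]: "insertion h \<sigma> (p + q) = insertion h \<sigma> p + insertion h \<sigma> q"
  using insertion_eq_sum[of "Poly_Mapping.keys p \<union> Poly_Mapping.keys q" p h \<sigma>]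
    insertion_eq_sum[of "Poly_Mapping.keys p \<union> Poly_Mapping.keys q" q h \<sigma>]
    insertion_eq_sum[of "Poly_Mapping.keys p \<union> Poly_Mapping.keys q" "p + q" h \<sigma>]
  by (simp add: keys_add hom_zero lookup_add hom_add distrib_right sum.distrib)

lemma insertion_sum: "insertion h \<sigma> (sum f A) = (\<Sum>a\<in>A. insertion h \<sigma> (f a))"
  by (induction A rule: infinite_finite_induct) auto

lemma insertion_mult [simp]: "insertion h \<sigma> (p * q) = insertion h \<sigma> p * insertion h \<sigma> q"
proof -
  have "p * q = (\<Sum>m\<in>Poly_Mapping.keys p. \<Sum>m'\<in>Poly_Mapping.keys q.
      Poly_Mapping.single (m + m') (Poly_Mapping.lookup p m * Poly_Mapping.lookup q m'))"
    unfolding mult_single[symmetric] sum_product[symmetric] mpoly_eq_sum[symmetric] ..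
  then have "insertion h \<sigma> (p * q) = (\<Sum>m\<in>Poly_Mapping.keys p. \<Sum>m'\<in>Poly_Mapping.keys q.
      insertion h \<sigma> (Poly_Mapping.single m (Poly_Mapping.lookup p m)) *
      insertion h \<sigma> (Poly_Mapping.single m' (Poly_Mapping.lookup q m')))"
    by (simp add: insertion_sum insertion_single prod_keys_power_add hom_mult mult_ac)
  also have "\<dots> = insertion h \<sigma> p * insertion h \<sigma> q"
    by (simp add: sum_product[symmetric] insertion_sum[symmetric] mpoly_eq_sum[symmetric])
  finally show ?thesis .
qed

lemma insertion_power [simp]: "insertion h \<sigma> (p ^ k) = insertion h \<sigma> p ^ k"
  by (induction k) auto

lemma insertion_prod: "insertion h \<sigma> (prod f A) = (\<Prod>a\<in>A. insertion h \<sigma> (f a))"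
  by (induction A rule: infinite_finite_induct) auto

lemma insertion_uminus [simp]: "insertion h \<sigma> (- p) = - insertion h \<sigma> p"
  using insertion_add[of \<sigma> p "- p"] by (simp add: add_eq_0_iff)

text \<open>Reduces identities between composed substitutions to the images of the variables. Both
  the action of \<open>G\<close> and its compatibility with the torus are checked this way.\<close>

lemma insertion_insertion:
  "insertion h \<sigma> (insertion const \<tau> p) = insertion h (\<lambda>i. insertion h \<sigma> (\<tau> i)) p"
  unfolding insertion_def[of const] insertion_def[of h "\<lambda>i. insertion h \<sigma> (\<tau> i)"]
  by (simp add: insertion_sum insertion_prod)

end

lemma const_hom: "coeff_hom const"
  by unfold_locales (simp_all add: const_def single_add mult_single)

interpretation const: coeff_hom const
  by (rule const_hom)

lemma single_eq_const_times_vars: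
  "Poly_Mapping.single m c = const c * (\<Prod>i\<in>Poly_Mapping.keys m. var i ^ Poly_Mapping.lookup m i)"
proof -
  have pw: "(var i :: 'a mpoly) ^ k = Poly_Mapping.single (Poly_Mapping.single i k) 1" for i k
    by (induction k) (simp_all add: var_def mult_single single_add[symmetric])
  have pr: "(\<Prod>i\<in>A. Poly_Mapping.single (f i) (1::'a)) = Poly_Mapping.single (\<Sum>i\<in>A. f i) 1"
    if "finite A" for A and f :: "nat \<Rightarrow> nat \<Rightarrow>\<^sub>0 nat"
    using that by induction (auto simp: mult_single)
  have "(\<Sum>i\<in>Poly_Mapping.keys m. Poly_Mapping.single i (Poly_Mapping.lookup m i)) = m"
    by (rule poly_mapping_eqI) (auto simp: lookup_sum lookup_single when_def in_keys_iff)
  then show ?thesis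
    by (simp add: pw pr const_def mult_single)
qed

lemma insertion_const_var [simp]: "insertion const var p = p"
  by (subst (2) mpoly_eq_sum) (simp add: insertion_def single_eq_const_times_vars)

lemma mpoly_decompose:
  "p = (\<Sum>m\<in>Poly_Mapping.keys p. const (Poly_Mapping.lookup p m) *
     (\<Prod>i\<in>Poly_Mapping.keys m. var i ^ Poly_Mapping.lookup m i))"
  using insertion_const_var[of p] by (simp add: insertion_def)

section \<open>Closure properties of the polynomial ring in \<open>n\<close> variables\<close>

lemma polys_const [simp, intro]: "const c \<in> polys n"
  by (auto simp: polys_def const_def)

lemma polys_zero [simp, intro]: "0 \<in> polys n"
  by (auto simp: polys_def)

lemma polys_one [simp, intro]: "1 \<in> polys n"
  by (auto simp: polys_def)

lemma polys_var [simp, intro]: "i < n \<Longrightarrow> var i \<in> polys n"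
  by (auto simp: polys_def var_def)

lemma polys_add [simp, intro]: "p \<in> polys n \<Longrightarrow> q \<in> polys n \<Longrightarrow> p + q \<in> polys n"
  unfolding polys_def by (blast dest: subsetD[OF keys_add])

lemma polys_mult [simp, intro]: "p \<in> polys n \<Longrightarrow> q \<in> polys n \<Longrightarrow> p * q \<in> polys n"
  unfolding polys_def by (blast dest: subsetD[OF keys_mult] subsetD[OF keys_add])

lemma polys_uminus [simp, intro]: "p \<in> polys n \<Longrightarrow> - p \<in> polys n"
  by (simp add: polys_def)

lemma polys_sum [intro]: "(\<And>a. a \<in> A \<Longrightarrow> f a \<in> polys n) \<Longrightarrow> sum f A \<in> polys n"
  by (induction A rule: infinite_finite_induct) auto

lemma polys_prod [intro]: "(\<And>a. a \<in> A \<Longrightarrow> f a \<in> polys n) \<Longrightarrow> prod f A \<in> polys n"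
  by (induction A rule: infinite_finite_induct) auto

lemma polys_power [intro]: "p \<in> polys n \<Longrightarrow> p ^ k \<in> polys n"
  by (induction k) auto

lemma polys_insertion:
  assumes "p \<in> polys n" "\<And>i. i < n \<Longrightarrow> \<tau> i \<in> polys n'"
  shows "insertion const \<tau> p \<in> polys n'"
  unfolding insertion_def
proof (intro polys_sum polys_mult polys_const polys_prod polys_power assms(2))
  fix m i assume "m \<in> Poly_Mapping.keys p" "i \<in> Poly_Mapping.keys m"
  then show "i < n"
    using assms(1) by (auto simp: polys_def)
qed

lemma insertion_cong:
  assumes "p \<in> polys n" "\<And>i. i < n \<Longrightarrow> \<sigma> i = \<tau> i"
  shows "insertion h \<sigma> p = insertion h \<tau> p"
  unfolding insertion_def
proof (intro sum.cong prod.cong arg_cong2[of _ _ _ _ "(*)"] refl)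
  fix m i assume "m \<in> Poly_Mapping.keys p" "i \<in> Poly_Mapping.keys m"
  then have "i < n"
    using assms(1) by (auto simp: polys_def)
  then show "\<sigma> i ^ Poly_Mapping.lookup m i = \<tau> i ^ Poly_Mapping.lookup m i"
    using assms(2) by simp
qed

lemma polys_le_cofinal: "p \<in> polys n \<Longrightarrow> \<exists>d. p \<in> polys_le n d"
proof -
  assume "p \<in> polys n"
  \<comment> \<open>The sum of the degrees of all monomials that occur is a crude bound for each of
    them.\<close>
  then have "p \<in> polys_le n (\<Sum>m\<in>Poly_Mapping.keys p. monom_degree m)"
    by (auto simp: polys_le_def intro!: member_le_sum)
  then show ?thesis ..
qed

section \<open>Subfields and algebraic elements of a field type\<close>

lemma type_ring_simps [simp]:
  "carrier ring_of_type_algebra = UNIV"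
  "x \<otimes>\<^bsub>ring_of_type_algebra\<^esub> y = x * y"
  "x \<oplus>\<^bsub>ring_of_type_algebra\<^esub> y = x + y"
  "\<one>\<^bsub>ring_of_type_algebra\<^esub> = 1"
  "\<zero>\<^bsub>ring_of_type_algebra\<^esub> = 0"
  by (simp_all add: ring_of_type_algebra_def)

interpretation type_ring: domain "ring_of_type_algebra :: 'a::field ring"
  by (rule field.axioms(1)[OF field_from_type_algebra])

lemma type_ring_a_inv [simp]: "\<ominus>\<^bsub>ring_of_type_algebra\<^esub> (x :: 'a::field) = - x"
  by (rule type_ring.minus_equality) auto

lemma type_ring_m_inv [simp]: "x \<noteq> 0 \<Longrightarrow> inv\<^bsub>ring_of_type_algebra\<^esub> (x :: 'a::field) = inverse x"
  by (rule type_ring.comm_inv_char) auto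

lemma type_ring_pow [simp]: "(x :: 'a::field) [^]\<^bsub>ring_of_type_algebra\<^esub> (k :: nat) = x ^ k"
  by (induction k) auto

lemma type_subfieldI:
  fixes S :: "'a::field set"
  assumes "0 \<in> S" "1 \<in> S" "\<And>x y. x \<in> S \<Longrightarrow> y \<in> S \<Longrightarrow> x + y \<in> S"
    "\<And>x y. x \<in> S \<Longrightarrow> y \<in> S \<Longrightarrow> x * y \<in> S" "\<And>x. x \<in> S \<Longrightarrow> - x \<in> S"
    "\<And>x. x \<in> S \<Longrightarrow> x \<noteq> 0 \<Longrightarrow> inverse x \<in> S"
  shows "subfield S ring_of_type_algebra"
  by (rule field.subfieldI'[OF field_from_type_algebra], rule type_ring.subringI) (use assms in auto)

lemma type_subfieldD:
  fixes S :: "'a::field set"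
  assumes "subfield S ring_of_type_algebra"
  shows "0 \<in> S" "1 \<in> S" "x \<in> S \<Longrightarrow> y \<in> S \<Longrightarrow> x + y \<in> S"
    "x \<in> S \<Longrightarrow> y \<in> S \<Longrightarrow> x * y \<in> S" "x \<in> S \<Longrightarrow> - x \<in> S"
    "x \<in> S \<Longrightarrow> inverse x \<in> S" "x \<in> S \<Longrightarrow> y \<in> S \<Longrightarrow> x / y \<in> S"
proof -
  note sr = subringE[OF subfieldE(1)[OF assms]]
  show inv: "inverse x \<in> S" if "x \<in> S" for x
    using type_ring.subfield_m_inv(1)[OF assms, of x] that sr(2) by (cases "x = 0") auto
  show mult: "x * y \<in> S" if "x \<in> S" "y \<in> S" for x y
    using sr(6) that by auto
  show "x \<in> S \<Longrightarrow> y \<in> S \<Longrightarrow> x / y \<in> S"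
    unfolding divide_inverse by (intro mult inv)
  show "x \<in> S \<Longrightarrow> y \<in> S \<Longrightarrow> x + y \<in> S"
    using sr(7)[of x y] by simp
  show "x \<in> S \<Longrightarrow> - x \<in> S"
    using sr(5)[of x] by simp
  show "0 \<in> S" "1 \<in> S"
    using sr(2,3) by simp_all
qed

text \<open>Polynomials over \<open>ring_of_type_algebra\<close> are lists with the leading
  coefficient first, while \<open>Poly\<close> starts with the constant term; hence the
  reversal.\<close>

lemma eval_type_ring:
  "type_ring.eval p x = poly (Poly (rev p)) (x :: 'a::field)"
  by (induction p) (auto simp: Poly_append poly_monom Poly_snoc)

text \<open>Allows algebraicity to be shown with type-based polynomials: the reversed coefficient
  list is normalized because the leading coefficient is nonzero.\<close>

lemma type_algebraicI:
  fixes Q :: "'a::field poly"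
  assumes "Q \<noteq> 0" "\<And>i. Polynomial.coeff Q i \<in> K" "poly Q x = 0"
  shows "(type_ring.algebraic over K) x"
proof (rule type_ring.algebraicI)
  have "set (rev (coeffs Q)) \<subseteq> K"
    using assms(2) by (auto simp: coeffs_def)
  then show "rev (coeffs Q) \<in> carrier (univ_poly ring_of_type_algebra K)"
    using assms(1)
    by (simp add: univ_poly_def polynomial_def hd_rev last_coeffs_eq_coeff_degree)
  show "rev (coeffs Q) \<noteq> []" "type_ring.eval (rev (coeffs Q)) x = \<zero>\<^bsub>ring_of_type_algebra\<^esub>"
    using assms by (simp_all add: eval_type_ring)
qed

lemma type_algebraicE:
  fixes x :: "'a::field"
  assumes "subring K ring_of_type_algebra" "(type_ring.algebraic over K) x"
  obtains Q where "Q \<noteq> 0" "\<And>i. Polynomial.coeff Q i \<in> K" "poly Q x = 0"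
proof -
  obtain p where p: "p \<in> carrier (univ_poly ring_of_type_algebra K)" "p \<noteq> []" "type_ring.eval p x = 0"
    using type_ring.algebraicE[OF assms(1) _ assms(2)] by auto
  have pK: "set p \<subseteq> K" and hd: "hd p \<noteq> 0"
    using p(1,2) by (auto simp: univ_poly_def polynomial_def)
  have cf: "Polynomial.coeff (Poly (rev p)) i = (if i < length p then rev p ! i else 0)" for i
    by (simp add: coeff_Poly_eq nth_default_def)
  show ?thesis
  proof
    show "Poly (rev p) \<noteq> 0"
    proof
      assume "Poly (rev p) = 0"
      then show False
        \<comment> \<open>The head of \<open>p\<close> is the leading coefficient and sits at index
          \<open>length p - 1\<close> after reversal.\<close>
        using p(2) hd cf[of "length p - 1"] by (simp del: coeff_Poly_eq add: rev_nth hd_conv_nth)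
    qed
    show "Polynomial.coeff (Poly (rev p)) i \<in> K" for i
    proof (cases "i < length p")
      case True
      then have "rev p ! i \<in> set p"
        by (metis length_rev nth_mem set_rev)
      then show ?thesis
        using True pK by (auto simp: nth_default_def)
    next
      case False
      then show ?thesis
        using subringE(2)[OF assms(1)] by (simp add: nth_default_def)
    qed
    show "poly (Poly (rev p)) x = 0"
      using p(3) by (simp add: eval_type_ring)
  qed
qed

section \<open>The embedding of polynomials into rational functions\<close>

lemma embed_zero [simp]: "embed 0 = 0"
  and embed_one [simp]: "embed 1 = 1"
  by (simp_all add: embed_def fract_collapse)

lemma embed_add [simp]: "embed (p + q) = embed p + embed q"
  and embed_mult [simp]: "embed (p * q) = embed p * embed q"
  and embed_uminus [simp]: "embed (- p) = - embed p"
  by (simp_all add: embed_def)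

lemma embed_eq_iff [simp]: "embed p = embed q \<longleftrightarrow> p = q"
  by (simp add: embed_def eq_fract)

lemma embed_eq_0_iff [simp]: "embed p = 0 \<longleftrightarrow> p = 0"
  using embed_eq_iff[of p 0] by simp

lemma embed_power [simp]: "embed (p ^ k) = embed p ^ k"
  by (induction k) simp_all

lemma Fract_eq_embed: "Fract a b = embed a / embed b"
  by (simp add: embed_def divide_fract)

lemma embed_sum: "embed (sum f A) = (\<Sum>a\<in>A. embed (f a))"
  by (induction A rule: infinite_finite_induct) auto

lemma embed_prod: "embed (prod f A) = (\<Prod>a\<in>A. embed (f a))"
  by (induction A rule: infinite_finite_induct) auto

lemma poly_map_poly_embed: "poly (map_poly embed Q) (embed x) = embed (poly Q x)"
  by (simp add: poly_altdef embed_sum degree_map_poly coeff_map_poly)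

text \<open>A ring homomorphism of the coefficients induces one of the polynomial rings; it is
  needed to move a group element through the product of the T - g x.\<close>

lemma map_poly_hom_prod:
  fixes f :: "'a::comm_ring_1 \<Rightarrow> 'b::comm_ring_1"
  assumes "\<And>x y. f (x + y) = f x + f y" "\<And>x y. f (x * y) = f x * f y" "f 1 = 1"
  shows "map_poly f (\<Prod>a\<in>A. P a) = (\<Prod>a\<in>A. map_poly f (P a))"
proof -
  have f0: "f 0 = 0"
    using assms(1)[of 0 0] by simp
  have fsum: "f (sum u B) = (\<Sum>b\<in>B. f (u b))" for u :: "nat \<Rightarrow> 'a" and B
    by (induction B rule: infinite_finite_induct) (auto simp: f0 assms)
  have mult: "map_poly f (p * q) = map_poly f p * map_poly f q" for p q
    by (rule poly_eqI) (simp add: coeff_map_poly f0 coeff_mult fsum assms(2))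
  show ?thesis
    by (induction A rule: infinite_finite_induct) (auto simp: mult assms(3))
qed

section \<open>Characters of finite abelian groups\<close>

text \<open>Were the field finite, the product of all T - a, plus 1, would be a nonconstant
  polynomial taking only the value 1.\<close>

lemma infinite_alg_closed_field: "infinite (UNIV :: 'a::alg_closed_field set)"
proof
  assume fin: "finite (UNIV :: 'a set)"
  define p :: "'a poly" where "p = (\<Prod>a\<in>UNIV. [:- a, 1:]) + 1"
  have "Polynomial.degree (\<Prod>a\<in>(UNIV :: 'a set). [:- a, 1:]) > 0"
    using fin by (subst degree_prod_eq_sum_degree) (auto simp: card_gt_0_iff)
  then have "Polynomial.degree p > 0"
    unfolding p_def by (subst degree_add_eq_left) simp_all
  then obtain z where "poly p z = 0"
    using alg_closed_imp_poly_has_root by blast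
  moreover have "poly (\<Prod>a\<in>UNIV. [:- a, 1:]) z = 0"
    using fin by (simp add: poly_prod)
  ultimately show False
    by (simp add: p_def)
qed

text \<open>Nothing is prescribed outside the carrier, and values on the carrier are automatically
  nonzero.\<close>

definition character :: "('g, 'm) monoid_scheme \<Rightarrow> ('g \<Rightarrow> 'a::field) \<Rightarrow> bool"
  where "character G \<chi> \<longleftrightarrow> \<chi> \<one>\<^bsub>G\<^esub> = 1 \<and>
    (\<forall>g\<in>carrier G. \<forall>h\<in>carrier G. \<chi> (g \<otimes>\<^bsub>G\<^esub> h) = \<chi> g * \<chi> h)"

context group
begin

lemma bij_betw_mult_left: "g \<in> carrier G \<Longrightarrow> bij_betw ((\<otimes>) g) (carrier G) (carrier G)"
  unfolding bij_betw_def using inj_on_cmult surj_const_mult by blast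

lemma sum_translate:
  "h \<in> carrier G \<Longrightarrow> (\<Sum>g\<in>carrier G. f (h \<otimes> g)) = (\<Sum>g\<in>carrier G. f g)"
  by (rule sum.reindex_bij_betw[OF bij_betw_mult_left])

lemma character_mult:
  "character G \<chi> \<Longrightarrow> g \<in> carrier G \<Longrightarrow> h \<in> carrier G \<Longrightarrow> \<chi> (g \<otimes> h) = \<chi> g * \<chi> h"
  by (simp add: character_def)

lemma character_nonzero:
  assumes "character G \<chi>" "g \<in> carrier G" shows "\<chi> g \<noteq> 0"
proof -
  have "\<chi> g * \<chi> (inv g) = 1"
    using assms character_mult[of \<chi> g "inv g"] by (simp add: character_def)
  then show ?thesis by auto
qed

lemma character_inverse: "character G \<chi> \<Longrightarrow> character G (\<lambda>g. inverse (\<chi> g))"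
  by (simp add: character_def)

lemma character_power2: "character G \<chi> \<Longrightarrow> character G (\<lambda>g. \<chi> g ^ 2)"
  by (simp add: character_def power_mult_distrib)

text \<open>Reindex by g \<mapsto> h g and use \<open>\<chi> h * inverse (\<chi> (h \<otimes> g)) =
  inverse (\<chi> g)\<close>. The map \<open>e\<close> admits functions \<open>f\<close> with values
  in a polynomial ring.\<close>

lemma sum_character_translate_hom:
  assumes "coeff_hom e" "character G \<chi>" "h \<in> carrier G"
  shows "(\<Sum>g\<in>carrier G. e (inverse (\<chi> g)) * f (h \<otimes> g)) =
    e (\<chi> h) * (\<Sum>g\<in>carrier G. e (inverse (\<chi> g)) * f g)"
proof -
  interpret coeff_hom e by fact
  have "e (\<chi> h) * (\<Sum>g\<in>carrier G. e (inverse (\<chi> g)) * f g) =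
      e (\<chi> h) * (\<Sum>g\<in>carrier G. e (inverse (\<chi> (h \<otimes> g))) * f (h \<otimes> g))"
    using sum_translate[OF assms(3), of "\<lambda>g. e (inverse (\<chi> g)) * f g"] by simp
  also have "\<dots> = (\<Sum>g\<in>carrier G. e (\<chi> h * inverse (\<chi> (h \<otimes> g))) * f (h \<otimes> g))"
    by (simp add: sum_distrib_left hom_mult mult.assoc)
  also have "\<dots> = (\<Sum>g\<in>carrier G. e (inverse (\<chi> g)) * f (h \<otimes> g))"
    by (rule sum.cong)
      (use assms character_nonzero[OF assms(2,3)] in
        \<open>simp_all add: character_mult nonzero_inverse_mult_distrib mult.assoc[symmetric]\<close>)
  finally show ?thesis ..
qed

lemma sum_character_translate:
  assumes "character G \<chi>" "h \<in> carrier G"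
  shows "(\<Sum>g\<in>carrier G. inverse (\<chi> g) * f (h \<otimes> g)) = \<chi> h * (\<Sum>g\<in>carrier G. inverse (\<chi> g) * f g)"
  by (rule sum_character_translate_hom[OF _ assms, of "\<lambda>x. x"]) (simp add: coeff_hom_def)

text \<open>Translation by \<open>h\<close> leaves the sum unchanged, yet multiplies it by
  \<open>\<chi> h\<close>, which is not 1.\<close>

lemma sum_character_eq_0:
  assumes "character G \<chi>" "h \<in> carrier G" "\<chi> h \<noteq> 1"
  shows "(\<Sum>g\<in>carrier G. \<chi> g) = 0"
proof -
  have "(\<Sum>g\<in>carrier G. \<chi> g) = (\<Sum>g\<in>carrier G. \<chi> (h \<otimes> g))"
    by (rule sum_translate[OF assms(2), symmetric])
  also have "\<dots> = \<chi> h * (\<Sum>g\<in>carrier G. \<chi> g)"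
    unfolding sum_distrib_left by (rule sum.cong) (use assms in \<open>simp_all add: character_mult\<close>)
  finally show ?thesis using assms(3) by simp
qed

end

section \<open>Characters occurring in a given function on the group\<close>

context comm_group
begin

text \<open>Let T be translation by \<open>k\<close>. A polynomial p of least degree with p(T) f = 0
  has a root \<open>z\<close>; writing p = (X - z) q, the function q(T) f is nonzero and an
  eigenfunction of T. It is given explicitly as a combination of translates of \<open>f\<close>, so
  that properties stable under translation pass to it.\<close>

lemma ex_translation_eigenfunction:
  fixes f :: "'a \<Rightarrow> 'f::alg_closed_field"
  assumes k: "k \<in> carrier G" and fin: "finite (carrier G)" and g0: "g\<^sub>0 \<in> carrier G" "f g\<^sub>0 \<noteq> 0"
  obtains q z g\<^sub>1 where
    "g\<^sub>1 \<in> carrier G" "(\<Sum>i\<le>Polynomial.degree q. Polynomial.coeff q i * f (k [^] i \<otimes> g\<^sub>1)) \<noteq> 0"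
    "\<And>g. g \<in> carrier G \<Longrightarrow> (\<Sum>i\<le>Polynomial.degree q. Polynomial.coeff q i * f (k [^] i \<otimes> (k \<otimes> g))) =
       z * (\<Sum>i\<le>Polynomial.degree q. Polynomial.coeff q i * f (k [^] i \<otimes> g))"
proof -
  \<comment> \<open>\<open>E p\<close> is p(T) f, and \<open>V p\<close> says that the nonzero
    polynomial \<open>p\<close> annihilates \<open>f\<close>.\<close>
  define E where "E p g = (\<Sum>i\<le>Polynomial.degree p. Polynomial.coeff p i * f (k [^] i \<otimes> g))" for p g
  define V where "V p \<longleftrightarrow> p \<noteq> 0 \<and> (\<forall>g\<in>carrier G. E p g = 0)" for p
  have E_eq: "E p g = (\<Sum>i\<le>M. Polynomial.coeff p i * f (k [^] i \<otimes> g))"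
    if "Polynomial.degree p \<le> M" for p g M
    unfolding E_def by (rule sum.mono_neutral_left) (use that in \<open>auto simp: coeff_eq_0\<close>)
  define N where "N = card (carrier G)"
  have N: "N > 0" "k [^] N = \<one>"
    using fin order_gt_0_iff_finite pow_order_eq_1[OF k] by (simp_all add: N_def Coset.order_def)
  \<comment> \<open>Some polynomial annihilates \<open>f\<close>, because T^N = 1 for the group
    order N.\<close>
  have "V (Polynomial.monom 1 N - 1)"
  proof -
    have deg: "Polynomial.degree (Polynomial.monom (1::'f) N - 1) \<le> N"
      by (intro degree_diff_le) (simp_all add: degree_monom_le)
    have "E (Polynomial.monom 1 N - 1) g = 0" if g: "g \<in> carrier G" for g
    proof -
      have "E (Polynomial.monom 1 N - 1) g = (\<Sum>i\<le>N. (if i = N then f g else 0) - (if i = 0 then f g else 0))"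
        unfolding E_eq[OF deg]
        by (rule sum.cong) (use g k N in \<open>auto simp: algebra_simps coeff_1\<close>)
      also have "\<dots> = 0"
        unfolding sum_subtractf by simp
      finally show ?thesis .
    qed
    moreover have "Polynomial.monom (1::'f) N - 1 \<noteq> 0"
    proof
      assume "Polynomial.monom (1::'f) N - 1 = 0"
      then have "Polynomial.coeff (Polynomial.monom (1::'f) N - 1) N = 0" by simp
      then show False using N by (simp add: coeff_1)
    qed
    ultimately show ?thesis by (simp add: V_def)
  qed
  then obtain p where p: "V p" "\<And>q. V q \<Longrightarrow> Polynomial.degree p \<le> Polynomial.degree q"
    using exists_least_iff[of "\<lambda>n. \<exists>p. V p \<and> Polynomial.degree p = n"] by (metis not_less)
  have "Polynomial.degree p \<noteq> 0"
  proof
    assume "Polynomial.degree p = 0"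
    then obtain c where c: "p = [:c:]" by (rule degree_eq_zeroE)
    then have "c \<noteq> 0" "E p g\<^sub>0 = 0"
      using p(1) g0 by (auto simp: V_def)
    then show False using g0 by (simp add: E_def c)
  qed
  then obtain z where "poly p z = 0"
    using alg_closed_imp_poly_has_root by blast
  then obtain q where q: "p = [:- z, 1:] * q"
    by (auto simp: poly_eq_0_iff_dvd elim: dvdE)
  have q0: "q \<noteq> 0" using p(1) q by (auto simp: V_def)
  then have deg: "Polynomial.degree p = Suc (Polynomial.degree q)"
    unfolding q by (subst degree_mult_eq) auto
  then have "\<not> V q" using p(2)[of q] by auto
  then obtain g1 where g1: "g1 \<in> carrier G" "E q g1 \<noteq> 0"
    using q0 by (auto simp: V_def)
  have "E q (k \<otimes> g) = z * E q g" if g: "g \<in> carrier G" for g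
  proof -
    let ?M = "Polynomial.degree q"
    \<comment> \<open>The coefficients of (X - z) q are those of q shifted by one, minus z times
      those of q; the shift amounts to one more translation by \<open>k\<close>.\<close>
    have "0 = E p g" using p(1) g by (simp add: V_def)
    also have "\<dots> = (\<Sum>i\<le>Suc ?M. (case i of 0 \<Rightarrow> 0 | Suc i \<Rightarrow> Polynomial.coeff q i) * f (k [^] i \<otimes> g))
        - (\<Sum>i\<le>Suc ?M. z * (Polynomial.coeff q i * f (k [^] i \<otimes> g)))"
      unfolding E_def deg sum_subtractf[symmetric]
      by (rule sum.cong) (simp_all add: q coeff_pCons algebra_simps split: nat.splits)
    also have "(\<Sum>i\<le>Suc ?M. (case i of 0 \<Rightarrow> 0 | Suc i \<Rightarrow> Polynomial.coeff q i) * f (k [^] i \<otimes> g)) = E q (k \<otimes> g)"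
      unfolding E_def sum.atMost_Suc_shift using g k by (simp add: m_assoc)
    also have "(\<Sum>i\<le>Suc ?M. z * (Polynomial.coeff q i * f (k [^] i \<otimes> g))) = z * E q g"
      unfolding sum_distrib_left[symmetric] by (simp add: E_eq[of q "Suc ?M"])
    finally show ?thesis by simp
  qed
  then show ?thesis using g1 that unfolding E_def by blast
qed

text \<open>The invariant carried through the induction: a common eigenfunction
  orthogonal to every character to which \<open>f\<close> is orthogonal.\<close>

lemma ex_common_eigenfunction:
  fixes f :: "'a \<Rightarrow> 'f::alg_closed_field"
  assumes fin: "finite (carrier G)" and g0: "g\<^sub>0 \<in> carrier G" "f g\<^sub>0 \<noteq> 0"
    and S: "finite S" "S \<subseteq> carrier G"
  shows "\<exists>\<phi>. (\<exists>g\<in>carrier G. \<phi> g \<noteq> 0) \<and>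
    (\<forall>h\<in>S. \<exists>z. \<forall>g\<in>carrier G. \<phi> (h \<otimes> g) = z * \<phi> g) \<and>
    (\<forall>\<chi>. character G \<chi> \<longrightarrow> (\<Sum>g\<in>carrier G. inverse (\<chi> g) * f g) = 0 \<longrightarrow>
      (\<Sum>g\<in>carrier G. inverse (\<chi> g) * \<phi> g) = 0)"
  using S
proof (induction S)
  case empty
  then show ?case using g0 by auto
next
  case (insert k S)
  then obtain \<phi> g1 where g1: "g1 \<in> carrier G" "\<phi> g1 \<noteq> 0"
    and eig: "\<And>h. h \<in> S \<Longrightarrow> \<exists>z. \<forall>g\<in>carrier G. \<phi> (h \<otimes> g) = z * \<phi> g"
    and orth: "\<And>\<chi>. character G \<chi> \<Longrightarrow> (\<Sum>g\<in>carrier G. inverse (\<chi> g) * f g) = 0 \<Longrightarrow>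
      (\<Sum>g\<in>carrier G. inverse (\<chi> g) * \<phi> g) = 0"
    by auto
  have k: "k \<in> carrier G" and SG: "S \<subseteq> carrier G" using insert by auto
  obtain q z g2 where g2: "g2 \<in> carrier G"
      "(\<Sum>i\<le>Polynomial.degree q. Polynomial.coeff q i * \<phi> (k [^] i \<otimes> g2)) \<noteq> 0"
    and z: "\<And>g. g \<in> carrier G \<Longrightarrow> (\<Sum>i\<le>Polynomial.degree q. Polynomial.coeff q i * \<phi> (k [^] i \<otimes> (k \<otimes> g))) =
       z * (\<Sum>i\<le>Polynomial.degree q. Polynomial.coeff q i * \<phi> (k [^] i \<otimes> g))"
    by (rule ex_translation_eigenfunction[of k g1 \<phi>, OF k fin g1]) blast
  define \<phi>' where "\<phi>' g = (\<Sum>i\<le>Polynomial.degree q. Polynomial.coeff q i * \<phi> (k [^] i \<otimes> g))" for g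
  have "\<exists>z. \<forall>g\<in>carrier G. \<phi>' (h \<otimes> g) = z * \<phi>' g" if h: "h \<in> S" for h
  proof -
    obtain w where w: "\<And>g. g \<in> carrier G \<Longrightarrow> \<phi> (h \<otimes> g) = w * \<phi> g"
      using eig[OF h] by auto
    have "\<phi>' (h \<otimes> g) = w * \<phi>' g" if g: "g \<in> carrier G" for g
    proof -
      \<comment> \<open>Translations commute because the group is abelian, so the eigenvalue
        equation for \<open>h\<close> survives.\<close>
      have "\<phi> (k [^] i \<otimes> (h \<otimes> g)) = w * \<phi> (k [^] i \<otimes> g)" for i :: nat
      proof -
        have "k [^] i \<otimes> (h \<otimes> g) = h \<otimes> (k [^] i \<otimes> g)"
          using k h g SG by (intro m_lcomm) auto
        then show ?thesis using w[of "k [^] i \<otimes> g"] k g by simp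
      qed
      then show ?thesis by (simp add: \<phi>'_def sum_distrib_left mult_ac)
    qed
    then show ?thesis by blast
  qed
  \<comment> \<open>Translating by a group element only multiplies the pairing with
    \<open>\<chi>\<close> by a scalar, so orthogonality passes to combinations of
    translates.\<close>
  moreover have "(\<Sum>g\<in>carrier G. inverse (\<chi> g) * \<phi>' g) = 0"
    if \<chi>: "character G \<chi>" and 0: "(\<Sum>g\<in>carrier G. inverse (\<chi> g) * f g) = 0" for \<chi>
  proof -
    have "(\<Sum>g\<in>carrier G. inverse (\<chi> g) * \<phi>' g) =
      (\<Sum>i\<le>Polynomial.degree q. Polynomial.coeff q i * (\<Sum>g\<in>carrier G. inverse (\<chi> g) * \<phi> (k [^] i \<otimes> g)))"
      unfolding \<phi>'_def sum_distrib_left by (subst sum.swap) (simp add: mult_ac)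
    also have "\<dots> = 0"
      using k by (simp add: sum_character_translate[OF \<chi>] orth[OF \<chi> 0])
    finally show ?thesis .
  qed
  ultimately show ?case
    using g2 z by (intro exI[of _ \<phi>']) (auto simp: \<phi>'_def)
qed

text \<open>A common eigenfunction of all translations is a multiple of a character
  \<open>\<psi>\<close>. Its pairing with \<open>\<psi>\<close> is \<open>card (carrier G)\<close>
  times its value at \<open>\<one>\<close>, hence nonzero, so \<open>f\<close> cannot be orthogonal
  to \<open>\<psi>\<close> either.\<close>

lemma ex_character_not_orthogonal:
  fixes f :: "'a \<Rightarrow> 'f::alg_closed_field"
  assumes fin: "finite (carrier G)" and card: "of_nat (card (carrier G)) \<noteq> (0 :: 'f)"
    and g0: "g\<^sub>0 \<in> carrier G" "f g\<^sub>0 \<noteq> 0"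
  obtains \<chi> where "character G \<chi>" "(\<Sum>g\<in>carrier G. inverse (\<chi> g) * f g) \<noteq> 0"
proof -
  obtain \<phi> g1 where g1: "g1 \<in> carrier G" "\<phi> g1 \<noteq> 0"
    and eig: "\<And>h. h \<in> carrier G \<Longrightarrow> \<exists>z. \<forall>g\<in>carrier G. \<phi> (h \<otimes> g) = z * \<phi> g"
    and orth: "\<And>\<chi>. character G \<chi> \<Longrightarrow> (\<Sum>g\<in>carrier G. inverse (\<chi> g) * f g) = 0 \<Longrightarrow>
      (\<Sum>g\<in>carrier G. inverse (\<chi> g) * \<phi> g) = 0"
    using ex_common_eigenfunction[of g\<^sub>0 f, OF fin g0 fin subset_refl] by blast
  obtain \<psi> where \<psi>: "\<And>g h. h \<in> carrier G \<Longrightarrow> g \<in> carrier G \<Longrightarrow> \<phi> (h \<otimes> g) = \<psi> h * \<phi> g"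
    using eig by metis
  have \<phi>: "\<phi> h = \<psi> h * \<phi> \<one>" if "h \<in> carrier G" for h
    using \<psi>[OF that one_closed] that by simp
  have ne: "\<phi> \<one> \<noteq> 0" using \<phi>[OF g1(1)] g1(2) by auto
  have char: "character G \<psi>"
    unfolding character_def
  proof (intro conjI ballI)
    show "\<psi> \<one> = 1" using \<phi>[OF one_closed] ne by (metis mult_cancel_right1)
    fix g h assume gh: "g \<in> carrier G" "h \<in> carrier G"
    have "\<psi> (g \<otimes> h) * \<phi> \<one> = \<psi> g * \<psi> h * \<phi> \<one>"
      using \<psi>[OF gh] \<phi>[OF gh(2)] \<phi>[of "g \<otimes> h"] gh by simp
    then show "\<psi> (g \<otimes> h) = \<psi> g * \<psi> h" using ne by simp
  qed
  have "inverse (\<psi> g) * \<phi> g = \<phi> \<one>" if "g \<in> carrier G" for g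
    using \<phi>[OF that] character_nonzero[OF char that] by simp
  then have "(\<Sum>g\<in>carrier G. inverse (\<psi> g) * \<phi> g) = (\<Sum>g\<in>carrier G. \<phi> \<one>)"
    by (rule sum.cong[OF refl])
  also have "\<dots> \<noteq> 0" using card ne by simp
  finally show ?thesis using orth[OF char] that[OF char] by blast
qed

end

section \<open>Invariants of a linear representation\<close>

lemma polys_coeff_prod:
  assumes "\<And>a i. a \<in> A \<Longrightarrow> Polynomial.coeff (P a) i \<in> polys n"
  shows "Polynomial.coeff (prod P A) i \<in> polys n"
  using assms
proof (induction A arbitrary: i rule: infinite_finite_induct)
  case (insert a A)
  then show ?case
    by (auto simp: coeff_mult intro!: polys_sum)
qed (auto simp: coeff_1)

context linear_representation
begin

abbreviation (input) "dm \<equiv> length bs"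

text \<open>The matrix of \<open>g\<close> on the variables: \<open>g x\<^sub>i\<close> is the sum of the \<open>act_coeff g i j * x\<^sub>j\<close>.\<close>

definition act_coeff :: "'g \<Rightarrow> nat \<Rightarrow> nat \<Rightarrow> 'k"
  where "act_coeff g i j = coord i (\<rho> (inv g) (bs ! j))"

lemma is_group: "group G"
  using group_hom group_hom.axioms(1) by blast

sublocale grp: group G
  by (rule is_group)

lemma coord_expand: "v = (\<Sum>j<dm. scale (coord j v) (bs ! j))"
proof -
  have "v = (\<Sum>b\<in>set bs. scale (representation (set bs) v b) b)"
    using sum_representation_eq[OF independent_Basis, of v "set bs"] span_Basis by simp
  also have "\<dots> = (\<Sum>j<dm. scale (coord j v) (bs ! j))"
    unfolding coord_def
    by (rule sum.reindex_bij_betw[symmetric])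
      (metis bij_betw_nth distinct_basis)
  finally show ?thesis .
qed

lemma coord_sum_scale:
  "coord i (\<Sum>j\<in>A. scale (c j) (f j)) = (\<Sum>j\<in>A. c j * coord i (f j))"
  unfolding coord_def using independent_Basis span_Basis
  by (simp add: representation_sum representation_scale)

lemma coord_basis: "i < dm \<Longrightarrow> j < dm \<Longrightarrow> coord i (bs ! j) = (if i = j then 1 else 0)"
  unfolding coord_def using independent_Basis distinct_basis
  by (simp add: representation_basis nth_eq_iff_index_eq)

lemma act_sum_scale:
  assumes "g \<in> carrier G"
  shows "\<rho> g (\<Sum>j\<in>A. scale (c j) (f j)) = (\<Sum>j\<in>A. scale (c j) (\<rho> g (f j)))"
proof -
  interpret l: Vector_Spaces.linear scale scale "\<rho> g"
    by (rule linear_action[OF assms])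
  show ?thesis by (simp add: l.sum l.scale)
qed

lemma act_one: "\<rho> \<one> v = v"
  using id_eq_one by (metis UNIV_I restrict_apply)

lemma act_mult: "g \<in> carrier G \<Longrightarrow> h \<in> carrier G \<Longrightarrow> \<rho> (g \<otimes> h) v = \<rho> g (\<rho> h v)"
  using composition_rule by simp

text \<open>Functions are acted on through the inverse, and inversion reverses the order of a
  product; so the matrix of \<open>h\<close> stands on the left.\<close>

lemma act_coeff_mult:
  assumes "g \<in> carrier G" "h \<in> carrier G"
  shows "act_coeff (g \<otimes> h) i l = (\<Sum>j<dm. act_coeff h i j * act_coeff g j l)"
proof -
  have "act_coeff (g \<otimes> h) i l = coord i (\<rho> (inv h) (\<rho> (inv g) (bs ! l)))"
    using assms by (simp add: act_coeff_def grp.inv_mult_group act_mult)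
  also have "\<dots> = coord i (\<rho> (inv h) (\<Sum>j<dm. scale (act_coeff g j l) (bs ! j)))"
    unfolding act_coeff_def coord_expand[symmetric] ..
  also have "\<dots> = (\<Sum>j<dm. act_coeff h i j * act_coeff g j l)"
    using assms by (simp add: act_sum_scale coord_sum_scale act_coeff_def mult.commute)
  finally show ?thesis .
qed

lemma act_coeff_one: "i < dm \<Longrightarrow> j < dm \<Longrightarrow> act_coeff \<one> i j = (if i = j then 1 else 0)"
  by (simp add: act_coeff_def act_one coord_basis)

lemma poly_act_eq: "poly_act g = insertion const (\<lambda>i. \<Sum>j<dm. const (act_coeff g i j) * var j)"
  by (simp add: poly_act_def act_coeff_def)

lemma poly_act_simps [simp]:
  "poly_act g 0 = 0" "poly_act g 1 = 1" "poly_act g (const c) = const c"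
  "poly_act g (p + q) = poly_act g p + poly_act g q" "poly_act g (p * q) = poly_act g p * poly_act g q"
  "poly_act g (- p) = - poly_act g p"
  by (simp_all add: poly_act_eq)

lemma poly_act_var: "poly_act g (var i) = (\<Sum>j<dm. const (act_coeff g i j) * var j)"
  by (simp add: poly_act_eq)

lemma poly_act_polys [simp, intro]: "p \<in> polys dm \<Longrightarrow> poly_act g p \<in> polys dm"
  unfolding poly_act_eq by (rule polys_insertion) (auto intro!: polys_sum)

lemma poly_act_one: "p \<in> polys dm \<Longrightarrow> poly_act \<one> p = p"
proof -
  assume p: "p \<in> polys dm"
  have "(\<Sum>j<dm. const (act_coeff \<one> i j) * var j) = var i" if "i < dm" for i
  proof -
    have "(\<Sum>j<dm. const (act_coeff \<one> i j) * var j) = (\<Sum>j<dm. if j = i then var i else 0)"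
      by (rule sum.cong) (use that in \<open>auto simp: act_coeff_one const.insertion_one const_def\<close>)
    then show ?thesis using that by simp
  qed
  then have "poly_act \<one> p = insertion const var p"
    unfolding poly_act_eq by (intro insertion_cong[OF p]) auto
  then show ?thesis by simp
qed

text \<open>Both sides are substitutions, so it suffices to compare them on the variables. There the
  reversed matrix product yields a left action.\<close>

lemma poly_act_mult:
  assumes "g \<in> carrier G" "h \<in> carrier G"
  shows "poly_act (g \<otimes> h) p = poly_act g (poly_act h p)"
proof -
  have "poly_act g (\<Sum>j<dm. const (act_coeff h i j) * var j) =
      (\<Sum>l<dm. const (act_coeff (g \<otimes> h) i l) * var l)" for i
  proof -
    have "poly_act g (\<Sum>j<dm. const (act_coeff h i j) * var j) =
        (\<Sum>j<dm. const (act_coeff h i j) * poly_act g (var j))"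
      by (simp add: poly_act_eq const.insertion_sum)
    also have "\<dots> = (\<Sum>j<dm. \<Sum>l<dm. const (act_coeff h i j) * const (act_coeff g j l) * var l)"
      by (simp add: poly_act_var sum_distrib_left mult.assoc)
    also have "\<dots> = (\<Sum>l<dm. \<Sum>j<dm. const (act_coeff h i j) * const (act_coeff g j l) * var l)"
      by (rule sum.swap)
    also have "\<dots> = (\<Sum>l<dm. const (act_coeff (g \<otimes> h) i l) * var l)"
      by (simp add: act_coeff_mult[OF assms] sum_distrib_right const.hom_mult const.hom_sum)
    finally show ?thesis .
  qed
  then show ?thesis
    by (simp add: poly_act_eq[of h] poly_act_eq[of "g \<otimes> h"]) (simp add: poly_act_eq const.insertion_insertion)
qed

lemma poly_act_inv_cancel:
  assumes "g \<in> carrier G" "p \<in> polys dm"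
  shows "poly_act (inv g) (poly_act g p) = p"
  using assms poly_act_mult[of "inv g" g p] by (simp add: poly_act_one)

section \<open>The action on rational functions and the invariant field\<close>

lemma poly_act_eq_0_iff:
  assumes "g \<in> carrier G" "p \<in> polys dm"
  shows "poly_act g p = 0 \<longleftrightarrow> p = 0"
  using poly_act_inv_cancel[OF assms] by auto

text \<open>The value does not depend on the representing fraction: \<open>poly_act g\<close> is
  multiplicative, and by injectivity on \<open>polys dm\<close> it keeps denominators
  nonzero.\<close>

lemma rat_act_Fract:
  assumes g: "g \<in> carrier G" and ab: "a \<in> polys dm" "b \<in> polys dm" "b \<noteq> 0"
  shows "rat_act g (Fract a b) = Fract (poly_act g a) (poly_act g b)"
  unfolding rat_act_def
proof (rule the_equality)
  fix r assume "\<exists>c\<in>polys dm. \<exists>d\<in>polys dm. d \<noteq> 0 \<and> Fract a b = Fract c d \<and> r = Fract (poly_act g c) (poly_act g d)"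
  then obtain c d where cd: "c \<in> polys dm" "d \<in> polys dm" "d \<noteq> 0" "Fract a b = Fract c d"
    and r: "r = Fract (poly_act g c) (poly_act g d)" by blast
  have "poly_act g (a * d) = poly_act g (c * b)"
    using cd ab by (simp add: eq_fract)
  then show "r = Fract (poly_act g a) (poly_act g b)"
    using r g ab cd by (simp add: eq_fract poly_act_eq_0_iff)
qed (use ab in blast)

text \<open>Cross-multiplication expresses invariance by polynomial identities; numerator and
  denominator need not be invariant separately.\<close>

lemma inv_rats_iff:
  "q \<in> inv_rats \<longleftrightarrow> (\<exists>a\<in>polys dm. \<exists>b\<in>polys dm. b \<noteq> 0 \<and> q = Fract a b \<and>
    (\<forall>g\<in>carrier G. poly_act g a * b = a * poly_act g b))"
proof -
  have *: "rat_act g (Fract a b) = Fract a b \<longleftrightarrow> poly_act g a * b = a * poly_act g b"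
    if "g \<in> carrier G" "a \<in> polys dm" "b \<in> polys dm" "b \<noteq> 0" for g a b
    using that by (simp add: rat_act_Fract eq_fract poly_act_eq_0_iff)
  then have "q \<in> inv_rats" if "a \<in> polys dm" "b \<in> polys dm" "b \<noteq> 0" "q = Fract a b"
      "\<forall>g\<in>carrier G. poly_act g a * b = a * poly_act g b" for a b
    using that by (auto simp: inv_rats_def rats_def)
  moreover have "\<exists>a\<in>polys dm. \<exists>b\<in>polys dm. b \<noteq> 0 \<and> q = Fract a b \<and>
    (\<forall>g\<in>carrier G. poly_act g a * b = a * poly_act g b)" if q: "q \<in> inv_rats"
  proof -
    obtain a b where "a \<in> polys dm" "b \<in> polys dm" "b \<noteq> 0" "q = Fract a b"
      using q by (auto simp: inv_rats_def rats_def)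
    then show ?thesis
      using q * by (intro bexI[of _ a] bexI[of _ b]) (auto simp: inv_rats_def)
  qed
  ultimately show ?thesis by blast
qed

lemma embed_in_inv_rats:
  assumes "p \<in> polys dm" "\<And>g. g \<in> carrier G \<Longrightarrow> poly_act g p = p"
  shows "embed p \<in> inv_rats"
  unfolding inv_rats_iff embed_def using assms by (intro bexI[of _ p] bexI[of _ 1]) auto

lemma inv_rats_subfield: "subfield inv_rats ring_of_type_algebra"
proof (rule type_subfieldI)
  have "embed 0 \<in> inv_rats" "embed 1 \<in> inv_rats"
    by (intro embed_in_inv_rats; simp)+
  then show "0 \<in> inv_rats" "1 \<in> inv_rats" by simp_all
next
  fix x y assume "x \<in> inv_rats" "y \<in> inv_rats"
  then obtain a b c d where *: "a \<in> polys dm" "b \<in> polys dm" "b \<noteq> 0" "x = Fract a b"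
    "\<And>g. g \<in> carrier G \<Longrightarrow> poly_act g a * b = a * poly_act g b"
    "c \<in> polys dm" "d \<in> polys dm" "d \<noteq> 0" "y = Fract c d"
    "\<And>g. g \<in> carrier G \<Longrightarrow> poly_act g c * d = c * poly_act g d"
    unfolding inv_rats_iff by metis
  have "x + y = Fract (a * d + c * b) (b * d)" "x * y = Fract (a * c) (b * d)"
    using * by simp_all
  moreover have "poly_act g (a * d + c * b) * (b * d) = (a * d + c * b) * poly_act g (b * d)"
    if "g \<in> carrier G" for g
  proof -
    have "poly_act g (a * d + c * b) * (b * d) =
      (poly_act g a * b) * (poly_act g d * d) + (poly_act g c * d) * (poly_act g b * b)"
      by (simp add: algebra_simps)
    also have "\<dots> = (a * d + c * b) * poly_act g (b * d)"
      unfolding *(5)[OF that] *(10)[OF that] by (simp add: algebra_simps)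
    finally show ?thesis .
  qed
  moreover have "poly_act g (a * c) * (b * d) = (a * c) * poly_act g (b * d)"
    if "g \<in> carrier G" for g
  proof -
    have "poly_act g (a * c) * (b * d) = (poly_act g a * b) * (poly_act g c * d)"
      by (simp add: algebra_simps)
    also have "\<dots> = (a * c) * poly_act g (b * d)"
      unfolding *(5)[OF that] *(10)[OF that] by (simp add: algebra_simps)
    finally show ?thesis .
  qed
  moreover have "a * d + c * b \<in> polys dm" "a * c \<in> polys dm" "b * d \<in> polys dm" "b * d \<noteq> 0"
    using * by auto
  ultimately show "x + y \<in> inv_rats" "x * y \<in> inv_rats"
    unfolding inv_rats_iff by blast+
next
  fix x assume "x \<in> inv_rats"
  then obtain a b where *: "a \<in> polys dm" "b \<in> polys dm" "b \<noteq> 0" "x = Fract a b"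
    "\<And>g. g \<in> carrier G \<Longrightarrow> poly_act g a * b = a * poly_act g b"
    unfolding inv_rats_iff by metis
  show "- x \<in> inv_rats"
    unfolding inv_rats_iff using * by (intro bexI[of _ "- a"] bexI[of _ b]) auto
  show "inverse x \<in> inv_rats" if "x \<noteq> 0"
  proof -
    have "a \<noteq> 0" using that * by (auto simp: fract_collapse)
    then show ?thesis
      unfolding inv_rats_iff using *
      by (intro bexI[of _ b] bexI[of _ a]) (auto simp: mult.commute)
  qed
qed

lemma inv_field_le_subfield: "subfield (inv_field_le d) ring_of_type_algebra"
  unfolding inv_field_le_def by (rule field.generate_field_is_subfield[OF field_from_type_algebra]) simp

lemma inv_field_le_subset: "inv_field_le d \<subseteq> inv_rats"
  unfolding inv_field_le_def
  by (rule field.generate_field_min_subfield1[OF field_from_type_algebra _ inv_rats_subfield])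
    (auto simp: inv_polys_le_def polys_le_def intro!: embed_in_inv_rats)

lemma embed_in_inv_field_le: "p \<in> inv_polys_le d \<Longrightarrow> embed p \<in> inv_field_le d"
  unfolding inv_field_le_def by (blast intro: generate_field.incl)

lemma embed_const_in_inv_field_le: "embed (const c) \<in> inv_field_le d"
  unfolding inv_field_le_def by (blast intro: generate_field.incl)

section \<open>Orbit polynomials and finiteness of the field extension\<close>

definition orbit_poly :: "nat \<Rightarrow> 'k mpoly poly"
  where "orbit_poly i = (\<Prod>g\<in>carrier G. [:- poly_act g (var i), 1:])"

lemma coeff_orbit_poly_polys:
  assumes "i < dm" shows "Polynomial.coeff (orbit_poly i) k \<in> polys dm"
  unfolding orbit_poly_def
  using assms by (intro polys_coeff_prod) (auto simp: coeff_pCons split: nat.splits)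

text \<open>Applying \<open>g\<close> permutes the linear factors. The product runs over the group
  rather than the orbit, so this is a mere reindexing even when factors repeat.\<close>

lemma poly_act_coeff_orbit_poly:
  assumes "g \<in> carrier G"
  shows "poly_act g (Polynomial.coeff (orbit_poly i) k) = Polynomial.coeff (orbit_poly i) k"
proof -
  have "map_poly (poly_act g) (orbit_poly i) = (\<Prod>h\<in>carrier G. map_poly (poly_act g) [:- poly_act h (var i), 1:])"
    unfolding orbit_poly_def by (rule map_poly_hom_prod) simp_all
  also have "\<dots> = (\<Prod>h\<in>carrier G. [:- poly_act (g \<otimes> h) (var i), 1:])"
    by (rule prod.cong) (simp_all add: map_poly_pCons poly_act_mult[OF assms])
  also have "\<dots> = orbit_poly i"
    unfolding orbit_poly_def
    using assms by (intro prod.reindex_bij_betw grp.bij_betw_mult_left)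
  finally have "Polynomial.coeff (map_poly (poly_act g) (orbit_poly i)) k = Polynomial.coeff (orbit_poly i) k"
    by simp
  then show ?thesis by (simp add: coeff_map_poly)
qed

lemma orbit_poly_root:
  assumes "i < dm" "finite (carrier G)"
  shows "poly (orbit_poly i) (var i) = 0"
  unfolding orbit_poly_def poly_prod
  using assms poly_act_one[of "var i"] by (auto simp: prod_zero_iff intro!: bexI[of _ \<one>])

lemma orbit_poly_nonzero:
  assumes "finite (carrier G)" shows "orbit_poly i \<noteq> 0"
  using assms by (simp add: orbit_poly_def prod_zero_iff)

text \<open>\<open>K\<close> is left open, as the lemma serves both for \<open>inv_rats\<close> and
  for \<open>inv_field_le d\<close>.\<close>

lemma var_algebraic:
  assumes "finite (carrier G)" "i < dm" "\<And>k. embed (Polynomial.coeff (orbit_poly i) k) \<in> K"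
  shows "(type_ring.algebraic over K) (embed (var i))"
proof (rule type_algebraicI)
  show "map_poly embed (orbit_poly i) \<noteq> 0"
    using orbit_poly_nonzero[OF assms(1)] by (simp add: map_poly_eq_0_iff)
  show "Polynomial.coeff (map_poly embed (orbit_poly i)) k \<in> K" for k
    using assms(3) by (simp add: coeff_map_poly)
  show "poly (map_poly embed (orbit_poly i)) (embed (var i)) = 0"
    using orbit_poly_root[OF assms(2,1)] by (simp add: poly_map_poly_embed)
qed


lemma embed_polys_subset:
  assumes "subfield E ring_of_type_algebra" "\<And>c. embed (const c) \<in> E" "\<And>i. i < n \<Longrightarrow> embed (var i) \<in> E"
    and p: "p \<in> polys n"
  shows "embed p \<in> E"
proof -
  note E = type_subfieldD[OF assms(1)]
  have sum: "sum f A \<in> E" if "\<And>a. a \<in> A \<Longrightarrow> f a \<in> E" for f :: "(nat \<Rightarrow>\<^sub>0 nat) \<Rightarrow> _" and A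
    using that by (induction A rule: infinite_finite_induct) (auto intro: E)
  have prod: "prod f A \<in> E" if "\<And>a. a \<in> A \<Longrightarrow> f a \<in> E" for f :: "nat \<Rightarrow> _" and A
    using that by (induction A rule: infinite_finite_induct) (auto intro: E)
  have pow: "x ^ k \<in> E" if "x \<in> E" for x k
    using that by (induction k) (auto intro: E)
  have "embed p = (\<Sum>m\<in>Poly_Mapping.keys p. embed (const (Poly_Mapping.lookup p m)) *
     (\<Prod>i\<in>Poly_Mapping.keys m. embed (var i) ^ Poly_Mapping.lookup m i))"
    by (subst mpoly_decompose) (simp add: embed_sum embed_prod)
  also have "\<dots> \<in> E"
    using p by (intro sum E(4) assms(2) prod pow assms(3)) (auto simp: polys_def)
  finally show ?thesis .
qed

lemma inv_rats_subalgebra: "subalgebra (inv_field_le d) inv_rats ring_of_type_algebra"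
proof -
  note E = type_subfieldD[OF inv_rats_subfield]
  have "subgroup inv_rats (add_monoid ring_of_type_algebra)"
    using subring.axioms(1)[OF subfieldE(1)[OF inv_rats_subfield]] .
  then show ?thesis
    using inv_field_le_subset[of d]
    by (intro subalgebra.intro subalgebra_axioms.intro) (auto intro: E)
qed

text \<open>Ensures that the least number defining \<open>gamma_field\<close> is attained. Once d
  bounds the degrees of all coefficients of the orbit polynomials, the variables are algebraic over
  \<open>inv_field_le d\<close>; they generate a finite extension that contains
  \<open>inv_rats\<close>.\<close>

lemma ex_finite_dimension:
  assumes fin: "finite (carrier G)"
  shows "\<exists>d. type_ring.finite_dimension (inv_field_le d) inv_rats"
proof -
  define C where "C = (\<Union>i<dm. Polynomial.coeff (orbit_poly i) ` UNIV)"
  have finC: "finite C" by (simp add: C_def range_coeff)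
  have "\<forall>p\<in>C. \<exists>d. p \<in> polys_le dm d"
    using polys_le_cofinal coeff_orbit_poly_polys by (auto simp: C_def)
  then obtain D where D: "\<And>p. p \<in> C \<Longrightarrow> p \<in> polys_le dm (D p)" by metis
  \<comment> \<open>The sum dominates the degree bound of each of the finitely many
    coefficients.\<close>
  define d where "d = sum D C"
  have Cd: "C \<subseteq> inv_polys_le d"
  proof
    fix p assume p: "p \<in> C"
    then have "D p \<le> d" unfolding d_def by (simp add: finC member_le_sum)
    then have "p \<in> polys_le dm d"
      using D[OF p] by (auto simp: polys_le_def intro: order.trans)
    then show "p \<in> inv_polys_le d"
      using p poly_act_coeff_orbit_poly by (auto simp: inv_polys_le_def C_def)
  qed
  define xs :: "'k mpoly fract list" where "xs = map (\<lambda>i. embed (var i)) [0..<dm]"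
  have alg: "(type_ring.algebraic over (inv_field_le d)) x" if "x \<in> set xs" for x
  proof -
    obtain i where i: "i < dm" "x = embed (var i)"
      using \<open>x \<in> set xs\<close> by (auto simp: xs_def)
    then have "Polynomial.coeff (orbit_poly i) k \<in> inv_polys_le d" for k
      using Cd by (auto simp: C_def)
    then show ?thesis
      using i fin by (auto intro: var_algebraic embed_in_inv_field_le)
  qed
  define E where "E = type_ring.finite_extension (inv_field_le d) xs"
  have E: "subfield E ring_of_type_algebra" "type_ring.finite_dimension (inv_field_le d) E"
    unfolding E_def
    using type_ring.finite_extension_is_subfield[OF inv_field_le_subfield _ alg]
      type_ring.finite_extension_finite_dimension(1)[OF inv_field_le_subfield _ alg] by auto
  have 1: "inv_field_le d \<subseteq> E"
    unfolding E_def by (rule type_ring.finite_extension_incl) simp_all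
  have 2: "set xs \<subseteq> E"
    unfolding E_def using subfieldE(1)[OF inv_field_le_subfield]
    by (rule type_ring.finite_extension_mem) simp
  have polys: "embed p \<in> E" if "p \<in> polys dm" for p
    by (rule embed_polys_subset[OF E(1) _ _ that])
      (use 1 2 embed_const_in_inv_field_le in \<open>auto simp: xs_def\<close>)
  \<comment> \<open>\<open>E\<close> is a field containing all polynomials in the variables, hence
    all their fractions.\<close>
  have "inv_rats \<subseteq> E"
    unfolding inv_rats_def rats_def
    using polys type_subfieldD(7)[OF E(1)] by (auto simp: Fract_eq_embed)
  then show ?thesis
    using type_ring.subalbegra_incl_imp_finite_dimension[OF inv_field_le_subfield E(2) inv_rats_subalgebra] by blast
qed

text \<open>Tower argument: adjoining the variable to \<open>inv_rats\<close> is a finite extension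
  by its orbit polynomial, and \<open>inv_rats\<close> is finite over \<open>inv_field_le d\<close>
  by assumption.\<close>

lemma var_algebraic_if_finite_dimension:
  assumes fin: "finite (carrier G)" and i: "i < dm"
    and fd: "type_ring.finite_dimension (inv_field_le d) inv_rats"
  shows "(type_ring.algebraic over (inv_field_le d)) (embed (var i))"
proof -
  have alg: "(type_ring.algebraic over inv_rats) (embed (var i))"
    using fin i
    by (intro var_algebraic embed_in_inv_rats coeff_orbit_poly_polys poly_act_coeff_orbit_poly)
  define E where "E = type_ring.simple_extension inv_rats (embed (var i))"
  have "type_ring.finite_dimension inv_rats E"
    using alg type_ring.finite_dimension_simple_extension[OF inv_rats_subfield] by (simp add: E_def)
  then have "type_ring.finite_dimension (inv_field_le d) E"
    by (rule type_ring.telescopic_base_dim(1)[OF inv_field_le_subfield inv_rats_subfield fd])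
  moreover have "subring E ring_of_type_algebra"
    unfolding E_def using subfieldE(1)[OF inv_rats_subfield]
    by (rule type_ring.simple_extension_is_subring) simp
  moreover have "embed (var i) \<in> E"
    unfolding E_def using subfieldE(1)[OF inv_rats_subfield]
    by (rule type_ring.simple_extension_mem) simp
  ultimately show ?thesis
    using type_ring.finite_dimension_imp_algebraic[OF inv_field_le_subfield] by blast
qed

end

section \<open>Invariants of degree at most two\<close>

text \<open>Splits off one variable, so that monomials of degree at most 2 can be enumerated by
  applying it twice.\<close>

lemma monom_degree_cases:
  assumes "m \<noteq> 0"
  obtains i m' where "m = Poly_Mapping.single i 1 + m'" "monom_degree m = Suc (monom_degree m')"
proof -
  obtain i where i: "i \<in> Poly_Mapping.keys m"
    using assms by (metis all_not_in_conv keys_eq_empty)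
  define m' where "m' = m - Poly_Mapping.single i 1"
  have m: "m = Poly_Mapping.single i 1 + m'"
    by (rule poly_mapping_eqI)
      (use i in \<open>auto simp: m'_def lookup_add lookup_minus lookup_single when_def in_keys_iff\<close>)
  have sub: "Poly_Mapping.keys m' \<subseteq> Poly_Mapping.keys m"
    by (auto simp: m lookup_add in_keys_iff)
  have "monom_degree m' = (\<Sum>j\<in>Poly_Mapping.keys m. Poly_Mapping.lookup m' j)"
    unfolding monom_degree_def
    by (rule sum.mono_neutral_left) (use sub in \<open>auto simp: in_keys_iff\<close>)
  moreover have "monom_degree m = (\<Sum>j\<in>Poly_Mapping.keys m. (if j = i then 1 else 0) + Poly_Mapping.lookup m' j)"
    unfolding monom_degree_def
    by (rule sum.cong) (auto simp: m lookup_add lookup_single when_def)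
  ultimately have "monom_degree m = Suc (monom_degree m')"
    using i by (simp add: sum.distrib)
  then show ?thesis using m that by blast
qed

lemma monom_degree_le_2_cases:
  assumes "monom_degree m \<le> 2"
  obtains "m = 0" | i where "m = Poly_Mapping.single i 1"
    | i j where "m = Poly_Mapping.single i 1 + Poly_Mapping.single j 1"
proof -
  have 0: "m = 0" if "monom_degree m = 0" for m
    using that monom_degree_cases[of m] by (metis nat.distinct(1))
  show ?thesis
  proof (cases "m = 0")
    case False
    then obtain i m' where m: "m = Poly_Mapping.single i 1 + m'" "monom_degree m = Suc (monom_degree m')"
      by (rule monom_degree_cases)
    show ?thesis
    proof (cases "m' = 0")
      case False
      then obtain j m'' where m': "m' = Poly_Mapping.single j 1 + m''" "monom_degree m' = Suc (monom_degree m'')"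
        by (rule monom_degree_cases)
      then have "m'' = 0" using m(2) assms 0 by simp
      then show ?thesis using m m' that(3) by simp
    qed (use m that in simp)
  qed (use that in simp)
qed

text \<open>The core of the degree-two case, with \<open>p\<close> a character, \<open>q\<close> its
  inverse, and \<open>u\<close>, \<open>v\<close> the orbits of two linear forms. Then
  \<open>a\<close>, \<open>b\<close> are the \<open>p\<close>- and \<open>q\<close>-components of
  \<open>u\<close>, and \<open>a'\<close>, \<open>b'\<close> those of \<open>v\<close>; the added
  terms scale them by \<open>t\<close> and \<open>s\<close>. The squares of \<open>p\<close> and
  \<open>q\<close> sum to 0, so only products of a \<open>p\<close>-part with a
  \<open>q\<close>-part can change, and they acquire the factor \<open>t * s = 1\<close>.\<close>

lemma sum_scaled_product:
  fixes p q u v :: "'g \<Rightarrow> 'r::comm_ring_1"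
  assumes pq: "\<And>g. g \<in> A \<Longrightarrow> p g * q g = 1"
    and p2: "(\<Sum>g\<in>A. p g ^ 2) = 0" and q2: "(\<Sum>g\<in>A. q g ^ 2) = 0"
    and ts: "t * s = 1"
    and a: "of_nat (card A) * a = (\<Sum>g\<in>A. q g * u g)" and b: "of_nat (card A) * b = (\<Sum>g\<in>A. p g * u g)"
    and a': "of_nat (card A) * a' = (\<Sum>g\<in>A. q g * v g)" and b': "of_nat (card A) * b' = (\<Sum>g\<in>A. p g * v g)"
  shows "(\<Sum>g\<in>A. (u g + (t - 1) * p g * a + (s - 1) * q g * b) * (v g + (t - 1) * p g * a' + (s - 1) * q g * b')) =
    (\<Sum>g\<in>A. u g * v g)"
proof -
  let ?x = "t - 1" and ?y = "s - 1" and ?n = "of_nat (card A) :: 'r"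
  have "(u g + ?x * p g * a + ?y * q g * b) * (v g + ?x * p g * a' + ?y * q g * b') =
     u g * v g + (?x * a' * (p g * u g) + ?y * b' * (q g * u g)) + (?x * a * (p g * v g) + ?y * b * (q g * v g))
     + (?x^2 * a * a' * p g ^ 2 + ?y^2 * b * b' * q g ^ 2) + ?x * ?y * (a * b' + b * a')"
    if "g \<in> A" for g
  proof -
    have "(u g + ?x * p g * a + ?y * q g * b) * (v g + ?x * p g * a' + ?y * q g * b') =
     u g * v g + (?x * a' * (p g * u g) + ?y * b' * (q g * u g)) + (?x * a * (p g * v g) + ?y * b * (q g * v g))
     + (?x^2 * a * a' * p g ^ 2 + ?y^2 * b * b' * q g ^ 2) + ?x * ?y * (a * b' + b * a') * (p g * q g)"
      by (simp add: algebra_simps power2_eq_square)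
    then show ?thesis by (simp add: pq[OF that])
  qed
  then have "(\<Sum>g\<in>A. (u g + ?x * p g * a + ?y * q g * b) * (v g + ?x * p g * a' + ?y * q g * b')) =
      (\<Sum>g\<in>A. u g * v g + (?x * a' * (p g * u g) + ?y * b' * (q g * u g)) + (?x * a * (p g * v g) + ?y * b * (q g * v g))
     + (?x^2 * a * a' * p g ^ 2 + ?y^2 * b * b' * q g ^ 2) + ?x * ?y * (a * b' + b * a'))"
    by (rule sum.cong[OF refl])
  also have "\<dots> = (\<Sum>g\<in>A. u g * v g) + (?x * a' * (?n * b) + ?y * b' * (?n * a)) + (?x * a * (?n * b') + ?y * b * (?n * a'))
      + ?n * (?x * ?y * (a * b' + b * a'))"
    unfolding sum.distrib sum_distrib_left[symmetric] a b a' b' p2 q2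
    by (simp add: a[symmetric] b[symmetric] a'[symmetric] b'[symmetric]) (simp add: algebra_simps)
  \<comment> \<open>The coefficients combine by (t - 1) + (s - 1) + (t - 1)(s - 1) = t s -
    1.\<close>
  also have "\<dots> = (\<Sum>g\<in>A. u g * v g) + ?n * (t * s - 1) * (a * b' + b * a')"
    by (simp add: algebra_simps)
  finally show ?thesis by (simp add: ts)
qed

section \<open>Extension of scalars and clearing of denominators\<close>

lemma to_ac_const_hom: "coeff_hom (\<lambda>c. const (to_ac c))"
  by unfold_locales (simp_all add: const.hom_add const.hom_mult const.hom_one)

interpretation ac: coeff_hom "\<lambda>c. const (to_ac c)"
  by (rule to_ac_const_hom)

lemma const_eq_iff [simp]: "const c = const d \<longleftrightarrow> c = d"
  by (simp add: const_def inj_eq)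

lemma const_eq_0_iff [simp]: "const c = 0 \<longleftrightarrow> c = 0"
  using const_eq_iff[of c 0] by (simp add: const.hom_zero del: const_eq_iff)

lemma of_nat_eq_const: "(of_nat n :: 'k::comm_ring_1 mpoly) = const (of_nat n)"
  by (simp add: const_def)

lemma lookup_insertion_to_ac:
  "Poly_Mapping.lookup (insertion (\<lambda>c. const (to_ac c)) var p) m = to_ac (Poly_Mapping.lookup p m)"
proof -
  have "insertion (\<lambda>c. const (to_ac c)) var p =
      (\<Sum>m\<in>Poly_Mapping.keys p. Poly_Mapping.single m (to_ac (Poly_Mapping.lookup p m)))"
    unfolding insertion_def single_eq_const_times_vars ..
  then show ?thesis
    by (auto simp: lookup_sum lookup_single when_def in_keys_iff)
qed

lemma insertion_to_ac_eq_0_iff: "insertion (\<lambda>c. const (to_ac c)) var p = 0 \<longleftrightarrow> p = 0"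
proof
  assume *: "insertion (\<lambda>c. const (to_ac c)) var p = 0"
  show "p = 0"
    by (rule poly_mapping_eqI) (use lookup_insertion_to_ac[of p] in \<open>simp add: *\<close>)
qed simp

lemma single_one_eq_iff: "Poly_Mapping.single i (Suc 0) = Poly_Mapping.single j (Suc 0) \<longleftrightarrow> i = j"
  by (metis keys_single singleton_inject nat.distinct(1))

lemma lookup_linear_form:
  "l < n \<Longrightarrow> Poly_Mapping.lookup (\<Sum>j<n. const (c j) * var j) (Poly_Mapping.single l 1) = c l"
proof -
  have "Poly_Mapping.lookup (\<Sum>j<n. const (c j) * var j) (Poly_Mapping.single l 1) =
      (\<Sum>j<n. if j = l then c l else 0)"
    unfolding lookup_sum
    by (rule sum.cong) (auto simp: const_def var_def mult_single lookup_single when_def single_one_eq_iff)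
  then show "l < n \<Longrightarrow> ?thesis" by simp
qed

text \<open>Clears the denominators of finitely many coefficients at once while staying inside
  \<open>A\<close>: the product of the denominators serves.\<close>

lemma common_denominator:
  fixes T :: "'k::field mpoly fract set"
  assumes "finite T" "\<And>x. x \<in> T \<Longrightarrow> \<exists>a\<in>A. \<exists>b\<in>A. b \<noteq> 0 \<and> x = Fract a b"
    and A: "1 \<in> A" "\<And>a b. a \<in> A \<Longrightarrow> b \<in> A \<Longrightarrow> a * b \<in> A"
  shows "\<exists>b\<in>A. b \<noteq> 0 \<and> (\<forall>x\<in>T. \<exists>a\<in>A. x * embed b = embed a)"
  using assms(1,2)
proof (induction T)
  case empty
  then show ?case using A(1) by (intro bexI[of _ 1]) auto
next
  case (insert y T)
  then obtain b where b: "b \<in> A" "b \<noteq> 0" "\<And>x. x \<in> T \<Longrightarrow> \<exists>a\<in>A. x * embed b = embed a"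
    by auto
  obtain c d where cd: "c \<in> A" "d \<in> A" "d \<noteq> 0" "y = Fract c d"
    using insert by blast
  have "y * embed (b * d) = embed (c * b)"
    using cd by (simp add: Fract_eq_embed)
  then have "\<exists>a\<in>A. y * embed (b * d) = embed a"
    using A b cd by blast
  moreover have "\<exists>a\<in>A. x * embed (b * d) = embed a" if x: "x \<in> T" for x
  proof -
    obtain a where a: "a \<in> A" "x * embed b = embed a" using b(3)[OF x] by blast
    then have "x * embed (b * d) = embed (a * d)" by (simp add: mult.assoc[symmetric])
    then show ?thesis using A a cd by blast
  qed
  ultimately show ?case
    using A b cd by (intro bexI[of _ "b * d"]) (simp_all del: embed_mult)
qed

text \<open>Applied to the ring \<open>A\<close> of torus-invariant polynomials, this bounds the
  field generated by invariants of low degree.\<close>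

lemma fractions_subfield:
  fixes A :: "'k::field mpoly set"
  assumes "0 \<in> A" "1 \<in> A" "\<And>a b. a \<in> A \<Longrightarrow> b \<in> A \<Longrightarrow> a + b \<in> A"
    "\<And>a b. a \<in> A \<Longrightarrow> b \<in> A \<Longrightarrow> a * b \<in> A" "\<And>a. a \<in> A \<Longrightarrow> - a \<in> A"
  shows "subfield {x. \<exists>a\<in>A. \<exists>b\<in>A. b \<noteq> 0 \<and> x = Fract a b} ring_of_type_algebra" (is "subfield ?S _")
proof (rule type_subfieldI)
  have emb: "embed a \<in> ?S" if "a \<in> A" for a
    using that assms(2) one_neq_zero unfolding embed_def by blast
  show "0 \<in> ?S" "1 \<in> ?S"
    using emb[OF assms(1)] emb[OF assms(2)] by simp_all
next
  fix x y assume "x \<in> ?S" "y \<in> ?S"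
  then obtain a b c d where *: "a \<in> A" "b \<in> A" "b \<noteq> 0" "x = Fract a b"
    "c \<in> A" "d \<in> A" "d \<noteq> 0" "y = Fract c d" by blast
  have "x + y = Fract (a * d + c * b) (b * d)" "x * y = Fract (a * c) (b * d)"
    using * by simp_all
  moreover have "b * d \<noteq> 0" "a * d + c * b \<in> A" "a * c \<in> A" "b * d \<in> A"
    using * assms by auto
  ultimately show "x + y \<in> ?S" "x * y \<in> ?S" by blast+
next
  fix x assume "x \<in> ?S"
  then obtain a b where *: "a \<in> A" "b \<in> A" "b \<noteq> 0" "x = Fract a b" by blast
  have "- x = Fract (- a) b" "inverse x = Fract b a" using * by simp_all
  moreover have "a \<noteq> 0" if "x \<noteq> 0" using that * by (auto simp: fract_collapse)
  ultimately show "- x \<in> ?S" "x \<noteq> 0 \<Longrightarrow> inverse x \<in> ?S"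
    using * assms(5) by blast+
qed

section \<open>The torus attached to a character\<close>

context linear_representation
begin

text \<open>\<open>orbit_form g i\<close> is \<open>g x\<^sub>i\<close>, \<open>isotypic \<chi> i\<close> the component of \<open>x\<^sub>i\<close> in the \<open>\<chi>\<close>-isotypic part,
  and \<open>torus \<chi> t g i\<close> the image of \<open>g x\<^sub>i\<close> under the torus element \<open>t\<close>, all after extension of scalars.\<close>

definition orbit_form :: "'g \<Rightarrow> nat \<Rightarrow> 'k alg_closure mpoly"
  where "orbit_form g i = (\<Sum>l<dm. const (to_ac (act_coeff g i l)) * var l)"

definition isotypic :: "('g \<Rightarrow> 'k alg_closure) \<Rightarrow> nat \<Rightarrow> 'k alg_closure mpoly"
  where "isotypic \<chi> i = const (inverse (of_nat (card (carrier G)))) *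
    (\<Sum>g\<in>carrier G. const (inverse (\<chi> g)) * orbit_form g i)"

definition torus :: "('g \<Rightarrow> 'k alg_closure) \<Rightarrow> 'k alg_closure \<Rightarrow> 'g \<Rightarrow> nat \<Rightarrow> 'k alg_closure mpoly"
  where "torus \<chi> t g i = orbit_form g i + (const t - 1) * const (\<chi> g) * isotypic \<chi> i +
    (const (inverse t) - 1) * const (inverse (\<chi> g)) * isotypic (\<lambda>g. inverse (\<chi> g)) i"

text \<open>At \<open>\<one>\<close> the forms \<open>torus\<close> are the images of the variables
  themselves; the substitution extends scalars at the same time.\<close>

abbreviation "torus_act \<chi> t \<equiv> insertion (\<lambda>c. const (to_ac c)) (torus \<chi> t \<one>)"

lemma orbit_form_mult:
  assumes "g \<in> carrier G" "h \<in> carrier G"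
  shows "orbit_form (g \<otimes> h) i = (\<Sum>j<dm. const (to_ac (act_coeff h i j)) * orbit_form g j)"
proof -
  have "(\<Sum>j<dm. const (to_ac (act_coeff h i j)) * orbit_form g j) =
      (\<Sum>j<dm. \<Sum>l<dm. const (to_ac (act_coeff h i j)) * const (to_ac (act_coeff g j l)) * var l)"
    by (simp add: orbit_form_def sum_distrib_left mult.assoc)
  also have "\<dots> = (\<Sum>l<dm. \<Sum>j<dm. const (to_ac (act_coeff h i j)) * const (to_ac (act_coeff g j l)) * var l)"
    by (rule sum.swap)
  also have "\<dots> = orbit_form (g \<otimes> h) i"
    by (simp add: orbit_form_def act_coeff_mult[OF assms] sum_distrib_right to_ac_sum const.hom_mult const.hom_sum)
  finally show ?thesis ..
qed

lemma orbit_form_one: "i < dm \<Longrightarrow> orbit_form \<one> i = var i"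
proof -
  assume i: "i < dm"
  have "orbit_form \<one> i = (\<Sum>l<dm. if l = i then var i else 0)"
    unfolding orbit_form_def
    by (rule sum.cong) (use i in \<open>auto simp: act_coeff_one const.hom_zero const.hom_one\<close>)
  then show ?thesis using i by simp
qed

context
  fixes \<chi> :: "'g \<Rightarrow> 'k alg_closure"
  assumes fin: "finite (carrier G)" and comm: "comm_group G"
    and card: "of_nat (card (carrier G)) \<noteq> (0 :: 'k alg_closure)"
    and \<chi>: "character G \<chi>"
begin

text \<open>The left side is the \<open>\<psi>\<close>-component of g x_i. As the group is abelian,
  translating the average by \<open>g\<close> produces the factor \<open>\<psi> g\<close>.\<close>

lemma isotypic_act:
  assumes \<psi>: "character G \<psi>" and g: "g \<in> carrier G"
  shows "(\<Sum>j<dm. const (to_ac (act_coeff g i j)) * isotypic \<psi> j) = const (\<psi> g) * isotypic \<psi> i"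
proof -
  interpret C: comm_group G by (rule comm)
  let ?N = "inverse (of_nat (card (carrier G)))"
  have "(\<Sum>j<dm. const (to_ac (act_coeff g i j)) * isotypic \<psi> j) =
      const ?N * (\<Sum>j<dm. \<Sum>h\<in>carrier G. const (inverse (\<psi> h)) * (const (to_ac (act_coeff g i j)) * orbit_form h j))"
    unfolding isotypic_def sum_distrib_left by (simp add: mult_ac)
  also have "\<dots> = const ?N * (\<Sum>h\<in>carrier G. const (inverse (\<psi> h)) * (\<Sum>j<dm. const (to_ac (act_coeff g i j)) * orbit_form h j))"
    by (subst sum.swap) (simp only: sum_distrib_left)
  also have "\<dots> = const ?N * (\<Sum>h\<in>carrier G. const (inverse (\<psi> h)) * orbit_form (g \<otimes> h) i)"
    using g by (simp add: orbit_form_mult[symmetric] C.m_comm)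
  also have "\<dots> = const (\<psi> g) * isotypic \<psi> i"
    unfolding grp.sum_character_translate_hom[OF const_hom \<psi> g, of "\<lambda>h. orbit_form h i"] isotypic_def
    by (simp add: mult_ac)
  finally show ?thesis .
qed

text \<open>The torus is compatible with \<open>G\<close> because \<open>g\<close> multiplies each
  isotypic component by a scalar. Averages over \<open>G\<close> thereby become sums of
  substitutions of \<open>torus \<chi> t g\<close>.\<close>

lemma torus_act_poly_act:
  assumes g: "g \<in> carrier G"
  shows "torus_act \<chi> t (poly_act g p) = insertion (\<lambda>c. const (to_ac c)) (torus \<chi> t g) p"
proof -
  have 1: "\<chi> \<one> = 1" using \<chi> by (simp add: character_def)
  have "(\<Sum>j<dm. const (to_ac (act_coeff g i j)) * torus \<chi> t \<one> j) = torus \<chi> t g i" for i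
  proof -
    have "(\<Sum>j<dm. const (to_ac (act_coeff g i j)) * torus \<chi> t \<one> j) =
      (\<Sum>j<dm. const (to_ac (act_coeff g i j)) * orbit_form \<one> j) +
      (const t - 1) * (\<Sum>j<dm. const (to_ac (act_coeff g i j)) * isotypic \<chi> j) +
      (const (inverse t) - 1) * (\<Sum>j<dm. const (to_ac (act_coeff g i j)) * isotypic (\<lambda>g. inverse (\<chi> g)) j)"
      unfolding torus_def 1 sum_distrib_left sum.distrib[symmetric]
      by (rule sum.cong) (simp_all add: const.hom_one ring_distribs mult_ac)
    also have "\<dots> = orbit_form g i + (const t - 1) * (const (\<chi> g) * isotypic \<chi> i) +
      (const (inverse t) - 1) * (const (inverse (\<chi> g)) * isotypic (\<lambda>g. inverse (\<chi> g)) i)"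
      using g orbit_form_mult[of \<one> g i]
      by (simp only: isotypic_act[OF \<chi> g] isotypic_act[OF grp.character_inverse[OF \<chi>] g]) simp
    finally show ?thesis by (simp only: torus_def mult.assoc)
  qed
  then show ?thesis
    by (simp add: poly_act_eq ac.insertion_insertion ac.insertion_sum)
qed

lemma card_isotypic:
  "of_nat (card (carrier G)) * isotypic \<psi> i = (\<Sum>g\<in>carrier G. const (inverse (\<psi> g)) * orbit_form g i)"
proof -
  have "of_nat (card (carrier G)) * const (inverse (of_nat (card (carrier G)))) = (1 :: 'k alg_closure mpoly)"
    using card by (simp add: of_nat_eq_const const.hom_mult[symmetric] const.hom_one)
  then show ?thesis by (simp add: isotypic_def mult.assoc[symmetric])
qed

section \<open>Invariance under the torus when \<open>\<chi>\<close> differs from its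
  inverse\<close>

context
  fixes k assumes k: "k \<in> carrier G" "\<chi> k ^ 2 \<noteq> 1"
begin

text \<open>Degree one: the correction terms are multiples of the sums of \<open>\<chi>\<close> and
  of its inverse, which vanish because neither is trivial.\<close>

lemma sum_torus: "(\<Sum>g\<in>carrier G. torus \<chi> t g i) = (\<Sum>g\<in>carrier G. orbit_form g i)"
proof -
  have "\<chi> k \<noteq> 1" "inverse (\<chi> k) \<noteq> 1" using k by auto
  then have "(\<Sum>g\<in>carrier G. \<chi> g) = 0" "(\<Sum>g\<in>carrier G. inverse (\<chi> g)) = 0"
    using grp.sum_character_eq_0[OF \<chi> k(1)] grp.sum_character_eq_0[OF grp.character_inverse[OF \<chi>] k(1)]
    by auto
  then have "(\<Sum>g\<in>carrier G. const (\<chi> g)) = 0" "(\<Sum>g\<in>carrier G. const (inverse (\<chi> g))) = 0"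
    by (simp_all add: const.hom_sum[symmetric] const.hom_zero)
  then show ?thesis
    by (simp add: torus_def sum.distrib sum_distrib_left[symmetric] sum_distrib_right[symmetric])
qed

text \<open>Degree two: since the square of \<open>\<chi>\<close> is nontrivial, the squares of
  \<open>\<chi>\<close> and of its inverse sum to 0, as \<open>sum_scaled_product\<close>
  requires.\<close>

lemma sum_torus_mult:
  assumes t: "t \<noteq> 0"
  shows "(\<Sum>g\<in>carrier G. torus \<chi> t g i * torus \<chi> t g j) = (\<Sum>g\<in>carrier G. orbit_form g i * orbit_form g j)"
  unfolding torus_def
proof (rule sum_scaled_product)
  show "const (\<chi> g) * const (inverse (\<chi> g)) = 1" if "g \<in> carrier G" for g
    using grp.character_nonzero[OF \<chi> that] by (simp add: const.hom_mult[symmetric] const.hom_one)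
  show "const t * const (inverse t) = 1"
    using t by (simp add: const.hom_mult[symmetric] const.hom_one)
  have "inverse (\<chi> k) ^ 2 \<noteq> 1" using k by (simp add: power_inverse)
  then have "(\<Sum>g\<in>carrier G. \<chi> g ^ 2) = 0" "(\<Sum>g\<in>carrier G. inverse (\<chi> g) ^ 2) = 0"
    using grp.sum_character_eq_0[OF grp.character_power2[OF \<chi>] k]
      grp.sum_character_eq_0[OF grp.character_power2[OF grp.character_inverse[OF \<chi>]] k(1)]
    by blast+
  then show "(\<Sum>g\<in>carrier G. const (\<chi> g) ^ 2) = 0" "(\<Sum>g\<in>carrier G. const (inverse (\<chi> g)) ^ 2) = 0"
    by (simp_all add: power2_eq_square const.hom_mult[symmetric] const.hom_sum[symmetric] const.hom_zero)
qed (simp_all add: card_isotypic)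

lemma sum_torus_monom:
  assumes t: "t \<noteq> 0" and m: "monom_degree m \<le> 2"
  shows "(\<Sum>g\<in>carrier G. \<Prod>i\<in>Poly_Mapping.keys m. torus \<chi> t g i ^ Poly_Mapping.lookup m i) =
    (\<Sum>g\<in>carrier G. \<Prod>i\<in>Poly_Mapping.keys m. orbit_form g i ^ Poly_Mapping.lookup m i)"
  using m
proof (cases rule: monom_degree_le_2_cases)
  case (2 i)
  then show ?thesis by (simp add: sum_torus)
next
  case (3 i j)
  show ?thesis unfolding 3 prod_keys_power_add by (simp add: sum_torus_mult[OF t])
qed simp

text \<open>Up to the invertible factor \<open>card (carrier G)\<close>, an invariant is the sum of
  its translates. After the torus is applied, this sum is independent of \<open>t\<close>, so it may
  be evaluated at \<open>t = 1\<close>, where the torus acts trivially.\<close>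

lemma torus_act_invariant:
  assumes t: "t \<noteq> 0" and f: "f \<in> inv_polys_le d" and d: "d \<le> 2"
  shows "torus_act \<chi> t f = insertion (\<lambda>c. const (to_ac c)) var f"
proof -
  have fp: "f \<in> polys dm" "\<And>m. m \<in> Poly_Mapping.keys f \<Longrightarrow> monom_degree m \<le> 2"
    "\<And>g. g \<in> carrier G \<Longrightarrow> poly_act g f = f"
    using f d by (auto simp: inv_polys_le_def polys_le_def intro: order.trans)
  have avg: "of_nat (card (carrier G)) * torus_act \<chi> t f =
      (\<Sum>m\<in>Poly_Mapping.keys f. const (to_ac (Poly_Mapping.lookup f m)) *
        (\<Sum>g\<in>carrier G. \<Prod>i\<in>Poly_Mapping.keys m. orbit_form g i ^ Poly_Mapping.lookup m i))"
    if t: "t \<noteq> 0" for t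
  proof -
    have "of_nat (card (carrier G)) * torus_act \<chi> t f = (\<Sum>g\<in>carrier G. torus_act \<chi> t (poly_act g f))"
      by (simp add: fp(3))
    also have "\<dots> = (\<Sum>g\<in>carrier G. insertion (\<lambda>c. const (to_ac c)) (torus \<chi> t g) f)"
      by (simp add: torus_act_poly_act)
    also have "\<dots> = (\<Sum>m\<in>Poly_Mapping.keys f. const (to_ac (Poly_Mapping.lookup f m)) *
        (\<Sum>g\<in>carrier G. \<Prod>i\<in>Poly_Mapping.keys m. torus \<chi> t g i ^ Poly_Mapping.lookup m i))"
      unfolding insertion_def sum_distrib_left by (rule sum.swap)
    finally show ?thesis
      using fp(2) sum_torus_monom[OF t] by simp
  qed
  have "torus_act \<chi> 1 f = insertion (\<lambda>c. const (to_ac c)) var f"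
    by (rule insertion_cong[OF fp(1)]) (simp add: torus_def const.hom_one orbit_form_one)
  moreover have "(of_nat (card (carrier G)) :: 'k alg_closure mpoly) \<noteq> 0"
    using card by (simp add: of_nat_eq_const)
  moreover have "of_nat (card (carrier G)) * torus_act \<chi> t f = of_nat (card (carrier G)) * torus_act \<chi> 1 f"
    unfolding avg[OF t] avg[OF one_neq_zero] ..
  ultimately show ?thesis
    by (simp only: mult_cancel_left) simp
qed

text \<open>The torus fixes the coefficients of an algebraic relation for x_i, so all images of x_i
  are roots of one nonzero polynomial. If the \<open>\<chi>\<close>-component were nonzero, each
  image would arise from at most two parameters, contradicting the infinitude of the field.\<close>

lemma isotypic_eq_0_if_algebraic:
  assumes d: "d \<le> 2" and i: "i < dm"
    and alg: "(type_ring.algebraic over (inv_field_le d)) (embed (var i))"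
  shows "isotypic \<chi> i = 0"
proof (rule ccontr)
  assume a: "isotypic \<chi> i \<noteq> 0"
  let ?\<iota> = "insertion (\<lambda>c. const (to_ac c)) var :: 'k mpoly \<Rightarrow> _"
  \<comment> \<open>The polynomials on which every torus element agrees with mere extension of
    scalars; their fractions form a field containing \<open>inv_field_le d\<close>.\<close>
  define A where "A = {p. \<forall>t. t \<noteq> 0 \<longrightarrow> torus_act \<chi> t p = ?\<iota> p}"
  have A: "0 \<in> A" "1 \<in> A" "\<And>a b. a \<in> A \<Longrightarrow> b \<in> A \<Longrightarrow> a + b \<in> A"
    "\<And>a b. a \<in> A \<Longrightarrow> b \<in> A \<Longrightarrow> a * b \<in> A" "\<And>a. a \<in> A \<Longrightarrow> - a \<in> A" "\<And>c. const c \<in> A"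
    by (simp_all add: A_def)
  have F: "inv_field_le d \<subseteq> {x. \<exists>a\<in>A. \<exists>b\<in>A. b \<noteq> 0 \<and> x = Fract a b}"
    unfolding inv_field_le_def
  proof (rule field.generate_field_min_subfield1[OF field_from_type_algebra _ fractions_subfield[OF A(1-5)]])
    have "embed p \<in> {x. \<exists>a\<in>A. \<exists>b\<in>A. b \<noteq> 0 \<and> x = Fract a b}" if "p \<in> A" for p
      using that A(2) one_neq_zero unfolding embed_def by blast
    moreover have "inv_polys_le d \<subseteq> A"
      using torus_act_invariant d by (auto simp: A_def)
    ultimately show "embed ` (range const \<union> inv_polys_le d) \<subseteq> {x. \<exists>a\<in>A. \<exists>b\<in>A. b \<noteq> 0 \<and> x = Fract a b}"
      using A(6) by blast
  qed simp
  obtain Q where Q: "Q \<noteq> 0" "\<And>j. Polynomial.coeff Q j \<in> inv_field_le d" "poly Q (embed (var i)) = 0"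
    using type_algebraicE[OF subfieldE(1)[OF inv_field_le_subfield] alg] by blast
  \<comment> \<open>With denominators cleared, the relation is one between polynomials, to which the
    torus substitution applies directly.\<close>
  have "\<exists>b\<in>A. b \<noteq> 0 \<and> (\<forall>x\<in>range (Polynomial.coeff Q). \<exists>a\<in>A. x * embed b = embed a)"
  proof (rule common_denominator[OF _ _ A(2,4)])
    show "finite (range (Polynomial.coeff Q))" by (simp add: range_coeff)
    show "\<exists>a\<in>A. \<exists>b\<in>A. b \<noteq> 0 \<and> x = Fract a b" if "x \<in> range (Polynomial.coeff Q)" for x
      using that Q(2) F by blast
  qed
  then obtain b where b: "b \<in> A" "b \<noteq> 0" "\<And>j. \<exists>a\<in>A. Polynomial.coeff Q j * embed b = embed a"
    by blast
  then obtain c where c: "\<And>j. c j \<in> A" "\<And>j. Polynomial.coeff Q j * embed b = embed (c j)"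
    by metis
  define n where "n = Polynomial.degree Q"
  have "c n \<noteq> 0"
    using c(2)[of n] b Q(1) by (auto simp: n_def)
  \<comment> \<open>The coefficients no longer depend on \<open>t\<close>; \<open>P\<close> is
    nonzero because extension of scalars is injective.\<close>
  define P where "P = (\<Sum>j\<le>n. Polynomial.monom (?\<iota> (c j)) j)"
  have "Polynomial.coeff P n = ?\<iota> (c n)"
    by (simp add: P_def coeff_sum)
  then have "P \<noteq> 0"
    using \<open>c n \<noteq> 0\<close> insertion_to_ac_eq_0_iff[of "c n"] by auto
  have "embed (\<Sum>j\<le>n. c j * var i ^ j) = embed b * poly Q (embed (var i))"
    by (simp add: embed_sum poly_altdef c(2)[symmetric] sum_distrib_left mult_ac n_def)
  then have rel: "(\<Sum>j\<le>n. c j * var i ^ j) = 0"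
    by (simp add: Q(3))
  have "poly P (torus \<chi> t \<one> i) = 0" if t: "t \<noteq> 0" for t
  proof -
    have "poly P (torus \<chi> t \<one> i) = (\<Sum>j\<le>n. ?\<iota> (c j) * torus \<chi> t \<one> i ^ j)"
      by (simp add: P_def poly_sum poly_monom)
    also have "\<dots> = torus_act \<chi> t (\<Sum>j\<le>n. c j * var i ^ j)"
      using c(1) t by (simp add: ac.insertion_sum A_def)
    finally show ?thesis by (simp add: rel)
  qed
  then have "(\<lambda>t. torus \<chi> t \<one> i) ` (UNIV - {0}) \<subseteq> {x. poly P x = 0}"
    by auto
  then have "finite ((\<lambda>t. torus \<chi> t \<one> i) ` (UNIV - {0}))"
    using poly_roots_finite[OF \<open>P \<noteq> 0\<close>] finite_subset by blast
  moreover have "infinite (UNIV - {0 :: 'k alg_closure})"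
    using infinite_alg_closed_field by simp
  \<comment> \<open>Infinitely many parameters have only finitely many images, so one image is
    shared by infinitely many of them.\<close>
  ultimately obtain t0 where t0: "infinite {t \<in> UNIV - {0}. torus \<chi> t \<one> i = torus \<chi> t0 \<one> i}"
    using pigeonhole_infinite by blast
  define a' where "a' = isotypic (\<lambda>g. inverse (\<chi> g)) i"
  define e where "e = const t0 * isotypic \<chi> i + const (inverse t0) * a'"
  \<comment> \<open>Multiplying the equality of the two images by \<open>t\<close> gives a quadratic
    equation in \<open>t\<close> whose leading coefficient is the
    \<open>\<chi>\<close>-component.\<close>
  have "poly [:a', - e, isotypic \<chi> i:] (const t) = 0"
    if t: "t \<noteq> 0" "torus \<chi> t \<one> i = torus \<chi> t0 \<one> i" for t
  proof -
    have 1: "\<chi> \<one> = 1" using \<chi> by (simp add: character_def)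
    have e: "const t * isotypic \<chi> i + const (inverse t) * a' = e"
      using t(2) by (simp add: torus_def 1 const.hom_one e_def a'_def algebra_simps)
    have "const t * e = const t * (const t * isotypic \<chi> i) + (const t * const (inverse t)) * a'"
      unfolding e[symmetric] by (simp add: algebra_simps)
    also have "const t * const (inverse t) = 1"
      using t by (simp add: const.hom_mult[symmetric] const.hom_one)
    finally show ?thesis by (simp add: algebra_simps)
  qed
  then have "const ` {t \<in> UNIV - {0}. torus \<chi> t \<one> i = torus \<chi> t0 \<one> i} \<subseteq> {x. poly [:a', - e, isotypic \<chi> i:] x = 0}"
    by auto
  moreover have "finite {x. poly [:a', - e, isotypic \<chi> i:] x = 0}"
    using a by (intro poly_roots_finite) simp
  ultimately have "finite (const ` {t \<in> UNIV - {0}. torus \<chi> t \<one> i = torus \<chi> t0 \<one> i})"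
    using finite_subset by blast
  then have "finite {t \<in> UNIV - {0}. torus \<chi> t \<one> i = torus \<chi> t0 \<one> i}"
    by (rule finite_imageD) (simp add: inj_on_def)
  then show False using t0 by blast
qed

end

end


text \<open>By faithfulness some matrix entry, as a function m on the group, satisfies m(k) \<noteq>
  m(1). The pairing of m(k g) - m(g) with \<open>\<chi>\<close> is \<open>\<chi> k - 1\<close> times
  that of m, so a character not orthogonal to this difference meets both requirements at
  once.\<close>

lemma ex_character_isotypic_nonzero:
  assumes fin: "finite (carrier G)" and comm: "comm_group G"
    and card: "of_nat (card (carrier G)) \<noteq> (0 :: 'k alg_closure)"
    and faithful: "faithful_action G UNIV \<rho>" and k: "k \<in> carrier G" "k \<noteq> \<one>"
  obtains \<chi> i where "character G \<chi>" "\<chi> k \<noteq> 1" "i < dm" "isotypic \<chi> i \<noteq> 0"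
proof -
  interpret C: comm_group G by (rule comm)
  have "\<exists>i<dm. \<exists>l<dm. act_coeff k i l \<noteq> act_coeff \<one> i l"
  proof (rule ccontr)
    assume "\<not> ?thesis"
    then have *: "act_coeff k i l = (if i = l then 1 else 0)" if "i < dm" "l < dm" for i l
      using that act_coeff_one by auto
    have "\<rho> (inv k) (bs ! l) = bs ! l" if l: "l < dm" for l
    proof -
      have "\<rho> (inv k) (bs ! l) = (\<Sum>j<dm. scale (act_coeff k j l) (bs ! j))"
        unfolding act_coeff_def by (rule coord_expand)
      also have "\<dots> = (\<Sum>j<dm. if j = l then bs ! l else 0)"
        by (rule sum.cong) (use l in \<open>auto simp: *\<close>)
      finally show ?thesis using l by simp
    qed
    then have "\<rho> (inv k) v = v" for v
    proof -
      assume fixed: "\<And>l. l < dm \<Longrightarrow> \<rho> (inv k) (bs ! l) = bs ! l"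
      have "\<rho> (inv k) (\<Sum>j<dm. scale (coord j v) (bs ! j)) = (\<Sum>j<dm. scale (coord j v) (bs ! j))"
        using k fixed by (subst act_sum_scale) simp_all
      then show ?thesis by (simp only: coord_expand[symmetric])
    qed
    then have "\<rho> (inv k) = \<rho> \<one>"
      by (simp add: fun_eq_iff act_one)
    then have "inv k = \<one>"
      using faithful k unfolding faithful_action_def faithful_action_axioms_def inj_on_def by blast
    then show False using k by simp
  qed
  then obtain i l where il: "i < dm" "l < dm" "act_coeff k i l \<noteq> act_coeff \<one> i l" by blast
  let ?f = "\<lambda>g. to_ac (act_coeff (k \<otimes> g) i l) - to_ac (act_coeff g i l)"
  have "?f \<one> \<noteq> 0"
    using il k by simp
  then obtain \<chi> where \<chi>: "character G \<chi>" "(\<Sum>g\<in>carrier G. inverse (\<chi> g) * ?f g) \<noteq> 0"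
    using C.ex_character_not_orthogonal[of \<one> ?f] fin card by blast
  define s where "s = (\<Sum>g\<in>carrier G. inverse (\<chi> g) * to_ac (act_coeff g i l))"
  have "(\<Sum>g\<in>carrier G. inverse (\<chi> g) * ?f g) =
      (\<Sum>g\<in>carrier G. inverse (\<chi> g) * to_ac (act_coeff (k \<otimes> g) i l)) - s"
    by (simp add: right_diff_distrib sum_subtractf s_def)
  also have "\<dots> = (\<chi> k - 1) * s"
    using grp.sum_character_translate[OF \<chi>(1) k(1), of "\<lambda>g. to_ac (act_coeff g i l)"]
    by (simp add: s_def left_diff_distrib)
  finally have ne: "\<chi> k \<noteq> 1" "s \<noteq> 0"
    using \<chi>(2) by auto
  have "isotypic \<chi> i = (\<Sum>l<dm. const (inverse (of_nat (card (carrier G))) *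
      (\<Sum>g\<in>carrier G. inverse (\<chi> g) * to_ac (act_coeff g i l))) * var l)"
  proof -
    have "(\<Sum>g\<in>carrier G. const (inverse (\<chi> g)) * orbit_form g i) =
        (\<Sum>l<dm. \<Sum>g\<in>carrier G. const (inverse (\<chi> g)) * (const (to_ac (act_coeff g i l)) * var l))"
      unfolding orbit_form_def sum_distrib_left by (rule sum.swap)
    then show ?thesis
      by (simp add: isotypic_def const.hom_mult const.hom_sum sum_distrib_left sum_distrib_right mult.assoc)
  qed
  \<comment> \<open>The pairing \<open>s\<close> of the matrix entry is, up to the group order, the
    coefficient of x_l in the \<open>\<chi>\<close>-component of x_i.\<close>
  then have "Poly_Mapping.lookup (isotypic \<chi> i) (Poly_Mapping.single l 1) =
      inverse (of_nat (card (carrier G))) * s"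
    using lookup_linear_form[OF il(2)] by (simp add: s_def)
  then have "isotypic \<chi> i \<noteq> 0"
    using ne(2) card by auto
  then show ?thesis using that \<chi>(1) ne(1) il(1) by blast
qed

end

theorem corollary3p6:
  fixes G :: "('g, 'm) monoid_scheme"
    and \<rho> :: "'g \<Rightarrow> 'v::ab_group_add \<Rightarrow> 'v"
    and scale :: "'k::field \<Rightarrow> 'v \<Rightarrow> 'v"
    and bs :: "'v list"
  assumes "comm_group G" and "finite (carrier G)"
    and "\<not> elementary_abelian_2_group G"
    and "\<not> CHAR('k) dvd card (carrier G)"
    and "linear_representation G \<rho> scale bs"
    and "faithful_action G UNIV \<rho>"
  shows "linear_representation.gamma_field G \<rho> scale bs \<ge> 3"
proof (rule ccontr)
  assume less: "\<not> ?thesis"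
  interpret linear_representation G \<rho> scale bs by fact
  have d: "gamma_field \<le> 2"
    using less by simp
  have fd: "type_ring.finite_dimension (inv_field_le gamma_field) inv_rats"
    unfolding gamma_field_def using ex_finite_dimension[OF assms(2)] by (rule LeastI_ex)
  have card: "of_nat (card (carrier G)) \<noteq> (0 :: 'k alg_closure)"
    using assms(4) by (simp add: of_nat_eq_0_iff_char_dvd)
  obtain g where g: "g \<in> carrier G" "g \<noteq> \<one>\<^bsub>G\<^esub>" "grp.ord g \<noteq> 2"
    using assms(1,3) by (auto simp: elementary_abelian_2_group_def)
  \<comment> \<open>An element of order neither 1 nor 2 has a nontrivial square.\<close>
  have "g \<otimes>\<^bsub>G\<^esub> g \<noteq> \<one>\<^bsub>G\<^esub>"
  proof
    assume "g \<otimes>\<^bsub>G\<^esub> g = \<one>\<^bsub>G\<^esub>"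
    then have "g [^]\<^bsub>G\<^esub> (2::nat) = \<one>\<^bsub>G\<^esub>"
      using g(1) by (simp add: numeral_2_eq_2)
    then have "grp.ord g dvd 2"
      using grp.pow_eq_id[OF g(1)] by blast
    then have "grp.ord g = 1"
      using g(3) by (metis prime_nat_iff two_is_prime_nat)
    then show False
      using g grp.ord_eq_1 by blast
  qed
  \<comment> \<open>Detecting the square of \<open>g\<close>, rather than \<open>g\<close>, yields a
    character whose square is nontrivial.\<close>
  then obtain \<chi> i where \<chi>: "character G \<chi>" "\<chi> (g \<otimes>\<^bsub>G\<^esub> g) \<noteq> 1" "i < dm" "isotypic \<chi> i \<noteq> 0"
    using ex_character_isotypic_nonzero[OF assms(2,1) card assms(6)] g(1) by (metis grp.m_closed)
  have "\<chi> g ^ 2 \<noteq> 1"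
    using \<chi>(1,2) g(1) by (simp add: grp.character_mult power2_eq_square)
  then have "isotypic \<chi> i = 0"
    using isotypic_eq_0_if_algebraic[OF assms(2,1) card \<chi>(1) g(1) _ d \<chi>(3)]
      var_algebraic_if_finite_dimension[OF assms(2) \<chi>(3) fd] by blast
  with \<chi>(4) show False by simp
qed

end
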